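(* If $G=K_{n_1}\,\Box\,K_{n_2}\,\Box\,\cdots\,\Box\,K_{n_d}$, where $2\le n_1\le n_2\le\dots\le n_d$, then \[ \mathrm{dmg}(G)\le\begin{cases}\displaystyle\frac{|V(G)|}{4}+\sum_{i=2}^{d}\ \prod_{j=3}^{i}n_j, & \text{if } n_1=n_2=2 \text{ and } n_d\le 3,\\[3ex] \displaystyle\frac{|V(G)|}{n_d}+\sum_{i=0}^{d-2}\ \prod_{j=1}^{i}n_j, & \text{otherwise,}\end{cases} \] and \[ \mathrm{dmg}(G)\ge\begin{cases}\displaystyle\frac{|V(G)|}{4}, & \text{if } n_1=n_2=2,\\[3ex] \displaystyle\frac{|V(G)|}{n_d}, & \text{otherwise.}\end{cases} \]
   Context: Graphs are finite and simple. $n_1,\dots,n_d$ are integers, $K_n$ is the complete graph on $n$ vertices and $\Box$ denotes the Cartesian product of graphs (vertices are $d$-tuples; two are adjacent iff they differ in exactly one coordinate and the entries in that coordinate are adjacent in the corresponding factor). $V(G)$ is the vertex set of $G$, so $|V(G)|=\prod_{j=1}^d n_j$. Empty products equal $1$. Damage number. One cop and one robber play on a graph $G$ with perfect information. First the cop chooses a starting vertex, then the robber chooses a starting vertex (this placement is round $0$). Each subsequent round consists of a move of the cop followed by a move of the robber; in a move a player either stays at the current vertex or moves to a neighboring vertex. If the cop ever occupies the same vertex as the robber, the robber is captured and the game ends. If a vertex $v$ is occupied by the robber at the end of a round and the robber is not caught in the following round, then $v$ becomes damaged and stays damaged for the rest of the game. The cop wants to minimize, and the robber to maximize, the number of damaged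 vertices. The damage number $\mathrm{dmg}(G)$ is the number of damaged vertices when both play optimally, i.e. the maximum number of vertices the robber can guarantee to damage no matter the strategy of the cop.
   Formalization: The lower bound |V|/4 is proved only when n_1=n_2=2 and n_d≤3 (|V|/n_d otherwise), and d≥2 is assumed; as printed it fails, e.g. for (2,2,8) it demands dmg≥8 while the upper bound gives 7, and for d=1, dmg(K_n)=0<1. *)

theory Defs
  imports Complex_Main "Graph_Theory.Pair_Digraph"
begin

text \<open>
  A finite simple graph is a \<^locale>\<open>pair_graph\<close>: a finite loop-free digraph whose arc set is
  symmetric, so that an edge is represented by both of its orientations.
\<close>

definition complete_graph :: "nat \<Rightarrow> nat pair_pre_digraph" where
  "complete_graph m = \<lparr>pverts = {..<m}, parcs = {(u, v). u < m \<and> v < m \<and> u \<noteq> v}\<rparr>"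

text \<open>The \<open>d\<close>-tuples are lists of length \<open>d\<close>, with coordinates counted from \<open>0\<close>.\<close>

definition product_verts :: "'a pair_pre_digraph list \<Rightarrow> 'a list set" where
  "product_verts Gs = {xs. length xs = length Gs \<and> (\<forall>i<length Gs. xs ! i \<in> pverts (Gs ! i))}"

definition cartesian_product :: "'a pair_pre_digraph list \<Rightarrow> 'a list pair_pre_digraph" where
  "cartesian_product Gs =
     \<lparr>pverts = product_verts Gs,
      parcs = {(xs, ys). xs \<in> product_verts Gs \<and> ys \<in> product_verts Gs \<and>
        (\<exists>i<length Gs. (xs ! i, ys ! i) \<in> parcs (Gs ! i) \<and>
           (\<forall>j<length Gs. j \<noteq> i \<longrightarrow> xs ! j = ys ! j))}\<rparr>"

lemma pair_graph_complete_graph: "pair_graph (complete_graph m)"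
proof -
  have verts: "pverts (complete_graph m) = {..<m}"
    and arcs: "(u, v) \<in> parcs (complete_graph m) \<longleftrightarrow> u < m \<and> v < m \<and> u \<noteq> v" for u v
    by (simp_all add: complete_graph_def)
  have sub: "parcs (complete_graph m) \<subseteq> {..<m} \<times> {..<m}"
    by (simp add: subset_iff arcs)
  show ?thesis
  proof
    show "finite (pverts (complete_graph m))"
      by (simp add: verts)
    show "finite (parcs (complete_graph m))"
      using sub by (rule finite_subset) simp
    have "sym (parcs (complete_graph m))"
      by (rule symI) (simp add: arcs)
    then show "symmetric (with_proj (complete_graph m))"
      by (simp add: symmetric_def)
    fix e assume e: "e \<in> parcs (complete_graph m)"
    then show "fst e \<in> pverts (complete_graph m)" "snd e \<in> pverts (complete_graph m)"
      "fst e \<noteq> snd e"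
      by (cases e; simp add: verts arcs)+
  qed
qed

lemma finite_product_verts:
  assumes "\<And>H. H \<in> set Gs \<Longrightarrow> finite (pverts H)"
  shows "finite (product_verts Gs)"
proof -
  have "product_verts Gs \<subseteq> {xs. set xs \<subseteq> (\<Union>H\<in>set Gs. pverts H) \<and> length xs = length Gs}"
  proof (intro subsetI CollectI conjI)
    fix xs x assume xs: "xs \<in> product_verts Gs"
    then show "length xs = length Gs"
      by (simp add: product_verts_def)
    assume "x \<in> set xs"
    then obtain i where "i < length xs" "x = xs ! i"
      by (metis in_set_conv_nth)
    with xs have "Gs ! i \<in> set Gs" "x \<in> pverts (Gs ! i)"
      by (simp_all add: product_verts_def)
    then show "x \<in> (\<Union>H\<in>set Gs. pverts H)"
      by blast
  qed
  then show ?thesis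
    by (rule finite_subset) (auto intro!: finite_lists_length_eq simp: assms)
qed

lemma parcs_cartesian_product_iff:
  "(xs, ys) \<in> parcs (cartesian_product Gs) \<longleftrightarrow>
     xs \<in> product_verts Gs \<and> ys \<in> product_verts Gs \<and>
     (\<exists>i<length Gs. (xs ! i, ys ! i) \<in> parcs (Gs ! i) \<and>
        (\<forall>j<length Gs. j \<noteq> i \<longrightarrow> xs ! j = ys ! j))"
  by (simp add: cartesian_product_def)

lemma pair_graph_cartesian_product:
  assumes "\<And>H. H \<in> set Gs \<Longrightarrow> pair_graph H"
  shows "pair_graph (cartesian_product Gs)"
proof -
  have fin: "finite (product_verts Gs)"
    using assms by (intro finite_product_verts) (simp add: pair_graph_def pair_digraph_def
        pair_fin_digraph.pair_finite_verts)
  have sub: "parcs (cartesian_product Gs) \<subseteq> product_verts Gs \<times> product_verts Gs"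
    by (auto simp: cartesian_product_def)
  then have fin_arcs: "finite (parcs (cartesian_product Gs))"
    by (rule finite_subset) (simp add: fin)
  have sym_Gs: "(b, a) \<in> parcs (Gs ! i)" if "(a, b) \<in> parcs (Gs ! i)" "i < length Gs" for a b i
  proof -
    interpret H: pair_graph "Gs ! i" using assms that(2) by simp
    show ?thesis using that(1) H.pair_sym_arcs
      by (auto simp: symmetric_def arcs_ends_def arc_to_ends_def sym_def)
  qed
  have loop_Gs: "(a, a) \<notin> parcs (Gs ! i)" if "i < length Gs" for a i
  proof -
    interpret H: pair_graph "Gs ! i" using assms that by simp
    show ?thesis using H.pair_no_loops by fastforce
  qed
  have sym_product: "(ys, xs) \<in> parcs (cartesian_product Gs)"
    if "(xs, ys) \<in> parcs (cartesian_product Gs)" for xs ys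
  proof -
    have verts: "xs \<in> product_verts Gs" "ys \<in> product_verts Gs"
      using that unfolding parcs_cartesian_product_iff by blast+
    from that have "\<exists>i<length Gs. (xs ! i, ys ! i) \<in> parcs (Gs ! i) \<and>
        (\<forall>j<length Gs. j \<noteq> i \<longrightarrow> xs ! j = ys ! j)"
      unfolding parcs_cartesian_product_iff by (elim conjE)
    then obtain i where i: "i < length Gs" "(xs ! i, ys ! i) \<in> parcs (Gs ! i)"
        "\<forall>j<length Gs. j \<noteq> i \<longrightarrow> xs ! j = ys ! j"
      by (elim exE conjE)
    show ?thesis
      unfolding parcs_cartesian_product_iff
    proof (intro conjI exI[of _ i] allI impI)
      show "(ys ! i, xs ! i) \<in> parcs (Gs ! i)"
        by (rule sym_Gs[OF i(2,1)])
      show "ys ! j = xs ! j" if "j < length Gs" "j \<noteq> i" for j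
        by (rule i(3)[rule_format, OF that, symmetric])
    qed (rule i verts)+
  qed
  have symmetric: "symmetric (with_proj (cartesian_product Gs))"
    using sym_product by (simp add: symmetric_def sym_def)
  have loop: "xs \<noteq> ys" if "(xs, ys) \<in> parcs (cartesian_product Gs)" for xs ys
    using that loop_Gs unfolding parcs_cartesian_product_iff by metis
  have verts: "pverts (cartesian_product Gs) = product_verts Gs"
    by (simp add: cartesian_product_def)
  show ?thesis
  proof
    show "finite (pverts (cartesian_product Gs))" "finite (parcs (cartesian_product Gs))"
      by (simp_all add: verts fin fin_arcs)
    show "symmetric (with_proj (cartesian_product Gs))"
      by (rule symmetric)
    fix e assume e: "e \<in> parcs (cartesian_product Gs)"
    then show "fst e \<in> pverts (cartesian_product Gs)" "snd e \<in> pverts (cartesian_product Gs)"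
      using sub by (auto simp: verts)
    show "fst e \<noteq> snd e"
      using e by (intro loop) simp
  qed
qed

definition closed_nbhd :: "'a pair_pre_digraph \<Rightarrow> 'a \<Rightarrow> 'a set" where
  "closed_nbhd G u = insert u {v \<in> pverts G. (u, v) \<in> parcs G}"

lemma closed_nbhd_subset: "u \<in> pverts G \<Longrightarrow> closed_nbhd G u \<subseteq> pverts G"
  by (auto simp: closed_nbhd_def)

text \<open>
  A history lists the pairs (cop's vertex, robber's vertex) at the ends of the completed rounds,
  the most recent round first.  In each round the cop chooses his vertex from the history, and the
  robber chooses his vertex from the history and the vertex just chosen by the cop; round \<open>0\<close>, the
  placement, is the round with empty history.
\<close>

type_synonym 'a history = "('a \<times> 'a) list"
type_synonym 'a cop_strategy = "'a history \<Rightarrow> 'a"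
type_synonym 'a robber_strategy = "'a history \<Rightarrow> 'a \<Rightarrow> 'a"

definition legal_cop :: "'a pair_pre_digraph \<Rightarrow> 'a cop_strategy \<Rightarrow> bool" where
  "legal_cop G \<sigma> \<longleftrightarrow> \<sigma> [] \<in> pverts G \<and>
     (\<forall>c\<in>pverts G. \<forall>r h. \<sigma> ((c, r) # h) \<in> closed_nbhd G c)"

definition legal_robber :: "'a pair_pre_digraph \<Rightarrow> 'a robber_strategy \<Rightarrow> bool" where
  "legal_robber G \<rho> \<longleftrightarrow> (\<forall>c'. \<rho> [] c' \<in> pverts G) \<and>
     (\<forall>r\<in>pverts G. \<forall>c h c'. \<rho> ((c, r) # h) c' \<in> closed_nbhd G r)"

primrec play :: "'a cop_strategy \<Rightarrow> 'a robber_strategy \<Rightarrow> nat \<Rightarrow> 'a history" where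
  "play \<sigma> \<rho> 0 = [(\<sigma> [], \<rho> [] (\<sigma> []))]"
| "play \<sigma> \<rho> (Suc t) =
     (let h = play \<sigma> \<rho> t; c = \<sigma> h in (c, \<rho> h c) # h)"

definition cop_at :: "'a cop_strategy \<Rightarrow> 'a robber_strategy \<Rightarrow> nat \<Rightarrow> 'a" where
  "cop_at \<sigma> \<rho> t = fst (hd (play \<sigma> \<rho> t))"

definition robber_at :: "'a cop_strategy \<Rightarrow> 'a robber_strategy \<Rightarrow> nat \<Rightarrow> 'a" where
  "robber_at \<sigma> \<rho> t = snd (hd (play \<sigma> \<rho> t))"

text \<open>
  The robber has been captured in round \<open>t\<close> or earlier.  In a round \<open>Suc s\<close> this happens if the cop
  moves onto the robber, who is still where he was at the end of round \<open>s\<close>, or if the robber moves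
  onto the cop.
\<close>

definition captured_by :: "'a cop_strategy \<Rightarrow> 'a robber_strategy \<Rightarrow> nat \<Rightarrow> bool" where
  "captured_by \<sigma> \<rho> t \<longleftrightarrow>
     (\<exists>s\<le>t. robber_at \<sigma> \<rho> s = cop_at \<sigma> \<rho> s) \<or>
     (\<exists>s<t. cop_at \<sigma> \<rho> (Suc s) = robber_at \<sigma> \<rho> s)"

text \<open>
  The function \<^const>\<open>play\<close> formally continues after a capture, but \<^const>\<open>captured_by\<close> remains
  true from then on, so that nothing is damaged once the game has ended.
\<close>

definition damaged :: "'a cop_strategy \<Rightarrow> 'a robber_strategy \<Rightarrow> 'a set" where
  "damaged \<sigma> \<rho> = {robber_at \<sigma> \<rho> t | t. \<not> captured_by \<sigma> \<rho> (Suc t)}"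

definition can_guarantee :: "'a pair_pre_digraph \<Rightarrow> nat \<Rightarrow> bool" where
  "can_guarantee G k \<longleftrightarrow>
     (\<exists>\<rho>. legal_robber G \<rho> \<and> (\<forall>\<sigma>. legal_cop G \<sigma> \<longrightarrow> k \<le> card (damaged \<sigma> \<rho>)))"

definition dmg :: "'a pair_pre_digraph \<Rightarrow> nat" where
  "dmg G = Max {k. can_guarantee G k}"

lemma play_in_verts:
  assumes "legal_cop G \<sigma>" "legal_robber G \<rho>"
  shows "cop_at \<sigma> \<rho> t \<in> pverts G \<and> robber_at \<sigma> \<rho> t \<in> pverts G"
proof (induction t)
  case 0
  then show ?case
    using assms by (simp add: cop_at_def robber_at_def legal_cop_def legal_robber_def)
next
  case (Suc t)
  obtain c r h where h: "play \<sigma> \<rho> t = (c, r) # h"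
    by (cases t) (auto simp: Let_def)
  have "c \<in> pverts G" "r \<in> pverts G"
    using Suc h by (auto simp: cop_at_def robber_at_def)
  moreover from this have "\<sigma> ((c, r) # h) \<in> closed_nbhd G c"
    "\<And>c'. \<rho> ((c, r) # h) c' \<in> closed_nbhd G r"
    using assms unfolding legal_cop_def legal_robber_def by blast+
  ultimately have "\<sigma> ((c, r) # h) \<in> pverts G" "\<And>c'. \<rho> ((c, r) # h) c' \<in> pverts G"
    by (blast dest: closed_nbhd_subset)+
  then show ?case
    by (simp add: cop_at_def robber_at_def h Let_def)
qed

text \<open>The maximum in the definition of \<^const>\<open>dmg\<close> is attained.\<close>

lemma finite_can_guarantee:
  assumes "finite (pverts G)" "pverts G \<noteq> {}"
  shows "finite {k. can_guarantee G k}" "{k. can_guarantee G k} \<noteq> {}"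
proof -
  obtain v where v: "v \<in> pverts G" using assms(2) by blast
  have cop: "legal_cop G (\<lambda>h. case h of [] \<Rightarrow> v | (c, r) # _ \<Rightarrow> c)"
    using v by (simp add: legal_cop_def closed_nbhd_def)
  have robber: "legal_robber G (\<lambda>h _. case h of [] \<Rightarrow> v | (c, r) # _ \<Rightarrow> r)"
    using v by (simp add: legal_robber_def closed_nbhd_def)
  have "k \<le> card (pverts G)" if k: "can_guarantee G k" for k
  proof -
    obtain \<rho> \<sigma> where "legal_robber G \<rho>" "legal_cop G \<sigma>" "k \<le> card (damaged \<sigma> \<rho>)"
      using k cop unfolding can_guarantee_def by blast
    moreover from this have "damaged \<sigma> \<rho> \<subseteq> pverts G"
      unfolding damaged_def using play_in_verts by blast
    ultimately show ?thesis
      using card_mono[OF assms(1)] by (meson le_trans)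
  qed
  then have "{k. can_guarantee G k} \<subseteq> {..card (pverts G)}"
    by blast
  then show "finite {k. can_guarantee G k}"
    by (rule finite_subset) simp
  have "can_guarantee G 0"
    using robber unfolding can_guarantee_def by blast
  then show "{k. can_guarantee G k} \<noteq> {}" by blast
qed

end

theory Submission
  imports Defs
begin

text \<open>
  \<^emph>\<open>Upper bounds.\<close>  The cop tries to agree with the robber in as many coordinates as possible.
  Consider the set of coordinates in which the two differ just after a move of the cop.  If the
  robber changes a coordinate outside this set, the cop can copy the change and the set is as before;
  if the robber stays or changes a coordinate inside it, the cop gains a coordinate.  So the game
  falls into phases, and during one phase the robber moves only in some of the coordinates: he
  stays in a subcube, and the damage is at most the sum, over all phases, of the sizes of
  these subcubes (\<open>card_damaged_le_phases\<close>).

  In general the cop always copies the \<^emph>\<open>first\<close> coordinate in which he differs from the robber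
  (\<open>match_first\<close>).  The phase is then the first coordinate \<open>p\<close> in which they still differ
  after the cop's move.  It never decreases, and while it is constant only coordinates
  below \<open>p\<close> change; this gives the sum of the products \<open>n\<^sub>1 \<cdots> n\<^sub>p\<close> for
  \<open>1 \<le> p < d\<close>.  It is at most the required bound except on hypercubes of dimension
  at least three.  On a hypercube a changed coordinate has only one possible new value, so a robber who changes a
  coordinate in which the two differ thereby makes them agree.  Hence the cop need never go below
  two differing coordinates before the capture, and by repairing exactly the coordinate
  that the robber has just spoiled (\<open>rematch\<close>) he leaves the robber a subcube of dimension
  \<open>p\<close> at most once for each \<open>p \<le> d - 2\<close>.

  \<^emph>\<open>Lower bounds.\<close>  If the robber cannot damage \<open>k\<close> vertices, consider a maximal set of
  visited vertices from which he cannot reach \<open>k\<close>.  From then on he visits nothing new,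
  so every safe move available to him stays inside the set of his possible positions:
  that set is a \<open>confinement\<close>, with fewer than \<open>k\<close> vertices
  (\<open>can_guarantee_unless_confined\<close>).  In a Hamming graph a cop can block all moves in one direction,
  or else at most one vertex in each of two directions.  So every vertex of a confinement has, except
  in dimension at most two, a direction in which the whole line through it lies in the confinement.
  Slicing across such a line and induction on the dimension bound the size of the confinement from
  below by \<open>|V| / N\<close>, where \<open>N\<close> bounds all factors and is at least \<open>4\<close> if two factors are
  equal to \<open>2\<close> (\<open>card_almost_full\<close>).
\<close>

section \<open>Hamming graphs\<close>

definition hamming :: "nat list \<Rightarrow> nat list pair_pre_digraph" where
  "hamming ns = cartesian_product (map complete_graph ns)"

lemma pverts_hamming:
  "pverts (hamming ns) = {xs. length xs = length ns \<and> (\<forall>i<length ns. xs ! i < ns ! i)}"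
  by (auto simp: hamming_def cartesian_product_def product_verts_def complete_graph_def)

lemma closed_nbhd_hamming_iff:
  assumes "xs \<in> pverts (hamming ns)"
  shows "ys \<in> closed_nbhd (hamming ns) xs \<longleftrightarrow>
    ys \<in> pverts (hamming ns) \<and> (\<exists>i. \<forall>j<length ns. j \<noteq> i \<longrightarrow> ys ! j = xs ! j)"
    (is "?l \<longleftrightarrow> ?r")
proof
  assume ?l
  then show ?r
    using assms
    by (auto simp: closed_nbhd_def hamming_def parcs_cartesian_product_iff) metis+
next
  assume r: ?r
  then obtain i where ys: "ys \<in> pverts (hamming ns)"
    and i: "\<forall>j<length ns. j \<noteq> i \<longrightarrow> ys ! j = xs ! j"
    by blast
  have eq: "product_verts (map complete_graph ns) = pverts (hamming ns)"
    by (simp add: hamming_def cartesian_product_def)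
  show ?l
  proof (cases "ys = xs")
    case False
    with i ys assms have "i < length ns" "xs ! i \<noteq> ys ! i"
      by (auto simp: pverts_hamming list_eq_iff_nth_eq)
    with i ys assms have "(xs, ys) \<in> parcs (hamming ns)"
      unfolding hamming_def parcs_cartesian_product_iff eq[unfolded hamming_def]
      by (auto simp: complete_graph_def pverts_hamming[unfolded hamming_def] intro!: exI[of _ i])
    with ys show ?thesis
      by (simp add: closed_nbhd_def)
  qed (simp add: closed_nbhd_def)
qed

lemma list_update_closed_nbhd:
  assumes "xs \<in> pverts (hamming ns)" "i < length ns \<Longrightarrow> x < ns ! i"
  shows "xs[i := x] \<in> closed_nbhd (hamming ns) xs"
proof -
  have "xs[i := x] \<in> pverts (hamming ns)"
    using assms by (cases "i < length ns") (auto simp: pverts_hamming nth_list_update)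
  then show ?thesis
    using assms(1) by (auto simp: closed_nbhd_hamming_iff intro!: exI[of _ i])
qed

lemma card_subcube:
  assumes "r \<in> pverts (hamming ns)" "S \<subseteq> {..<length ns}"
  shows "card {xs \<in> pverts (hamming ns). \<forall>j<length ns. j \<notin> S \<longrightarrow> xs ! j = r ! j} =
    (\<Prod>i\<in>S. ns ! i)"
    (is "card ?C = _")
proof -
  have "finite S"
    using assms(2) by (rule finite_subset) simp
  have "bij_betw (\<lambda>xs. restrict ((!) xs) S) ?C (PiE S (\<lambda>i. {..<ns ! i}))"
  proof (rule bij_betw_byWitness[where
        f' = "\<lambda>f. map (\<lambda>i. if i \<in> S then f i else r ! i) [0..<length ns]"])
    show "\<forall>xs\<in>?C. map (\<lambda>i. if i \<in> S then restrict ((!) xs) S i else r ! i) [0..<length ns] = xs"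
    proof
      fix xs
      assume "xs \<in> ?C"
      then have "length xs = length ns" "\<forall>j<length ns. j \<notin> S \<longrightarrow> xs ! j = r ! j"
        by (simp_all add: pverts_hamming)
      then show "map (\<lambda>i. if i \<in> S then restrict ((!) xs) S i else r ! i) [0..<length ns] = xs"
        by (intro nth_equalityI) simp_all
    qed
    show "\<forall>f\<in>PiE S (\<lambda>i. {..<ns ! i}).
        restrict ((!) (map (\<lambda>i. if i \<in> S then f i else r ! i) [0..<length ns])) S = f"
    proof (intro ballI ext)
      fix f x
      assume f: "f \<in> PiE S (\<lambda>i. {..<ns ! i})"
      show "restrict ((!) (map (\<lambda>i. if i \<in> S then f i else r ! i) [0..<length ns])) S x = f x"
      proof (cases "x \<in> S")
        case True
        moreover from this have "x < length ns"
          using assms(2) by blast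
        ultimately show ?thesis
          by simp
      qed (simp add: PiE_arb[OF f])
    qed
    show "(\<lambda>xs. restrict ((!) xs) S) ` ?C \<subseteq> PiE S (\<lambda>i. {..<ns ! i})"
      using subsetD[OF assms(2)] by (auto simp: pverts_hamming)
    show "(\<lambda>f. map (\<lambda>i. if i \<in> S then f i else r ! i) [0..<length ns]) ` PiE S (\<lambda>i. {..<ns ! i}) \<subseteq> ?C"
      using assms(1) by (auto simp: pverts_hamming dest: PiE_mem)
  qed
  then have "card ?C = card (PiE S (\<lambda>i. {..<ns ! i}))"
    by (rule bij_betw_same_card)
  also have "\<dots> = (\<Prod>i\<in>S. ns ! i)"
    using \<open>finite S\<close> by (simp add: card_PiE)
  finally show ?thesis .
qed

lemma finite_pverts_hamming: "finite (pverts (hamming ns))"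
proof -
  interpret pair_graph "hamming ns"
    unfolding hamming_def
    by (rule pair_graph_cartesian_product) (auto intro: pair_graph_complete_graph)
  show ?thesis
    by (rule pair_finite_verts)
qed

lemma zero_in_hamming:
  assumes "\<And>i. i < length ns \<Longrightarrow> 0 < ns ! i"
  shows "replicate (length ns) 0 \<in> pverts (hamming ns)"
  using assms by (simp add: pverts_hamming)

lemma card_pverts_hamming:
  assumes "\<And>i. i < length ns \<Longrightarrow> 0 < ns ! i"
  shows "card (pverts (hamming ns)) = (\<Prod>i<length ns. ns ! i)"
  using card_subcube[OF zero_in_hamming[OF assms], of "{..<length ns}"] by simp

section \<open>The course of a game\<close>

lemma play_Suc_Cons:
  "play \<sigma> \<rho> (Suc t) = (cop_at \<sigma> \<rho> (Suc t), robber_at \<sigma> \<rho> (Suc t)) # play \<sigma> \<rho> t"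
  by (simp add: cop_at_def robber_at_def Let_def)

lemma play_Cons: "\<exists>h. play \<sigma> \<rho> t = (cop_at \<sigma> \<rho> t, robber_at \<sigma> \<rho> t) # h"
  by (cases t) (auto simp: cop_at_def robber_at_def Let_def)

lemma cop_at_Suc: "cop_at \<sigma> \<rho> (Suc t) = \<sigma> (play \<sigma> \<rho> t)"
  by (simp add: cop_at_def Let_def)

lemma robber_at_Suc: "robber_at \<sigma> \<rho> (Suc t) = \<rho> (play \<sigma> \<rho> t) (cop_at \<sigma> \<rho> (Suc t))"
  by (simp add: cop_at_def robber_at_def Let_def)

lemma cop_at_Suc_closed_nbhd:
  assumes "legal_cop G \<sigma>" "legal_robber G \<rho>"
  shows "cop_at \<sigma> \<rho> (Suc t) \<in> closed_nbhd G (cop_at \<sigma> \<rho> t)"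
  using play_Cons[of \<sigma> \<rho> t] play_in_verts[OF assms, of t] assms(1)
  by (auto simp: cop_at_Suc legal_cop_def)

lemma robber_at_Suc_closed_nbhd:
  assumes "legal_cop G \<sigma>" "legal_robber G \<rho>"
  shows "robber_at \<sigma> \<rho> (Suc t) \<in> closed_nbhd G (robber_at \<sigma> \<rho> t)"
  using play_Cons[of \<sigma> \<rho> t] play_in_verts[OF assms, of t] assms(2)
  by (auto simp: robber_at_Suc legal_robber_def)

lemma captured_by_mono: "captured_by \<sigma> \<rho> s \<Longrightarrow> s \<le> t \<Longrightarrow> captured_by \<sigma> \<rho> t"
  unfolding captured_by_def by (meson le_trans less_le_trans)

lemma damaged_subset_pverts:
  assumes "legal_cop G \<sigma>" "legal_robber G \<rho>"
  shows "damaged \<sigma> \<rho> \<subseteq> pverts G"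
  unfolding damaged_def using play_in_verts[OF assms] by blast

lemma dmg_le:
  assumes "finite (pverts G)" "legal_cop G \<sigma>"
    and "\<And>\<rho>. legal_robber G \<rho> \<Longrightarrow> card (damaged \<sigma> \<rho>) \<le> b"
  shows "dmg G \<le> b"
proof -
  have "pverts G \<noteq> {}"
    using assms(2) by (auto simp: legal_cop_def)
  from Max_in[OF finite_can_guarantee[OF assms(1) this]] have "can_guarantee G (dmg G)"
    by (simp add: dmg_def)
  then show ?thesis
    using assms(2,3) unfolding can_guarantee_def by (meson le_trans)
qed

lemma dmg_ge:
  assumes "finite (pverts G)" "pverts G \<noteq> {}" "can_guarantee G k"
  shows "k \<le> dmg G"
  unfolding dmg_def using finite_can_guarantee[OF assms(1,2)] assms(3) by (simp add: Max_ge)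

section \<open>Confining the robber in phases\<close>

text \<open>
  Phases do not decrease, so the rounds of one phase are consecutive.  Within them only
  the coordinates in \<open>free t\<close> change, hence all positions of the robber in one phase lie in a single
  subcube.
\<close>

lemma card_damaged_le_phases:
  fixes phase :: "nat \<Rightarrow> nat" and free :: "nat \<Rightarrow> nat set" and b :: "nat \<Rightarrow> nat"
  assumes legal: "legal_cop (hamming ns) \<sigma>" "legal_robber (hamming ns) \<rho>"
    and step: "\<And>t. \<not> captured_by \<sigma> \<rho> (Suc (Suc t)) \<Longrightarrow> phase t \<le> phase (Suc t) \<and>
      (phase (Suc t) = phase t \<longrightarrow> free (Suc t) = free t \<and>
        (\<forall>j<length ns. j \<notin> free t \<longrightarrow> robber_at \<sigma> \<rho> (Suc t) ! j = robber_at \<sigma> \<rho> t ! j))"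
    and bound: "\<And>t. \<not> captured_by \<sigma> \<rho> (Suc t) \<Longrightarrow>
      phase t \<in> P \<and> free t \<subseteq> {..<length ns} \<and> (\<Prod>i\<in>free t. ns ! i) \<le> b (phase t)"
    and "finite P"
  shows "card (damaged \<sigma> \<rho>) \<le> (\<Sum>p\<in>P. b p)"
proof -
  define r where "r = robber_at \<sigma> \<rho>"
  define Q where "Q p = {r t | t. \<not> captured_by \<sigma> \<rho> (Suc t) \<and> phase t = p}" for p
  have mono: "phase s \<le> phase t \<and> (phase t = phase s \<longrightarrow> free t = free s \<and>
        (\<forall>j<length ns. j \<notin> free s \<longrightarrow> r t ! j = r s ! j))"
    if "s \<le> t" "\<not> captured_by \<sigma> \<rho> (Suc t)" for s t
    using that
  proof (induction t rule: dec_induct)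
    case (step t)
    then have "\<not> captured_by \<sigma> \<rho> (Suc t)"
      using captured_by_mono by (meson le_SucI order_refl)
    with step.IH assms(3)[of t] step.prems show ?case
      unfolding r_def by (metis le_antisym le_trans)
  qed simp
  have "card (Q p) \<le> b p" for p
  proof (cases "Q p = {}")
    case False
    then obtain t0 where t0: "\<not> captured_by \<sigma> \<rho> (Suc t0)" "phase t0 = p"
      by (auto simp: Q_def)
    let ?C = "{xs \<in> pverts (hamming ns). \<forall>j<length ns. j \<notin> free t0 \<longrightarrow> xs ! j = r t0 ! j}"
    have "Q p \<subseteq> ?C"
    proof
      fix x assume "x \<in> Q p"
      then obtain t where t: "x = r t" "\<not> captured_by \<sigma> \<rho> (Suc t)" "phase t = p"
        by (auto simp: Q_def)
      have "x \<in> pverts (hamming ns)"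
        using play_in_verts[OF legal, of t] t(1) by (simp add: r_def)
      moreover have "\<forall>j<length ns. j \<notin> free t0 \<longrightarrow> r t ! j = r t0 ! j"
        using mono[of t t0] mono[of t0 t] t t0 by (metis nle_le)
      ultimately show "x \<in> ?C"
        using t(1) by simp
    qed
    then have "card (Q p) \<le> card ?C"
      using finite_pverts_hamming by (intro card_mono) auto
    also have "\<dots> = (\<Prod>i\<in>free t0. ns ! i)"
      using play_in_verts[OF legal, of t0] bound[OF t0(1)]
      by (intro card_subcube) (auto simp: r_def)
    also have "\<dots> \<le> b p"
      using bound[OF t0(1)] t0(2) by simp
    finally show ?thesis .
  qed simp
  moreover have "damaged \<sigma> \<rho> = (\<Union>p\<in>P. Q p)"
    using bound by (fastforce simp: damaged_def Q_def r_def)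
  ultimately show ?thesis
    using card_UN_le[OF \<open>finite P\<close>, of Q] by (metis (no_types, lifting) le_trans sum_mono)
qed

definition differing :: "'a list \<Rightarrow> 'a list \<Rightarrow> nat set" where
  "differing xs ys = {i. i < length xs \<and> xs ! i \<noteq> ys ! i}"

lemma finite_differing: "finite (differing xs ys)"
  by (simp add: differing_def)

lemma differing_empty_iff: "length xs = length ys \<Longrightarrow> differing xs ys = {} \<longleftrightarrow> xs = ys"
  by (auto simp: differing_def list_eq_iff_nth_eq)

lemma differing_list_update:
  "differing (xs[i := ys ! i]) ys = differing xs ys - {i}"
proof (rule set_eqI)
  fix j
  show "j \<in> differing (xs[i := ys ! i]) ys \<longleftrightarrow> j \<in> differing xs ys - {i}"
    by (cases "j = i") (simp_all add: differing_def)
qed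

section \<open>A cop who copies the first differing coordinate\<close>

text \<open>
  A legal strategy has to answer every history, also those with a robber outside the graph or on
  the cop's own vertex.  The first are caught by the test; on the second \<^const>\<open>Min\<close> is applied to the empty
  set, and copying any coordinate then changes nothing.
\<close>

definition match_first :: "nat list \<Rightarrow> nat list cop_strategy" where
  "match_first ns h = (case h of
      [] \<Rightarrow> replicate (length ns) 0
    | (c, r) # _ \<Rightarrow>
        if r \<in> pverts (hamming ns) then let i = Min (differing c r) in c[i := r ! i] else c)"

lemma legal_match_first:
  assumes "\<And>i. i < length ns \<Longrightarrow> 0 < ns ! i"
  shows "legal_cop (hamming ns) (match_first ns)"
proof -
  have "match_first ns ((c, r) # h) \<in> closed_nbhd (hamming ns) c"
    if "c \<in> pverts (hamming ns)" for c r h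
  proof (cases "r \<in> pverts (hamming ns)")
    case True
    with that show ?thesis
      by (auto simp: match_first_def Let_def pverts_hamming intro!: list_update_closed_nbhd)
  next
    case False
    then show ?thesis
      by (simp add: match_first_def closed_nbhd_def)
  qed
  then show ?thesis
    using zero_in_hamming[OF assms] by (simp add: legal_cop_def match_first_def)
qed

text \<open>
  Let \<open>E t\<close> be the set of differing coordinates after the cop's move and \<open>p t\<close> its minimum.
  If the robber changes coordinate \<open>i\<close>, then the two can now differ in no coordinate
  below \<open>p t\<close> other than \<open>i\<close>.  The cop's next move removes the first differing coordinate, so \<open>p\<close>
  cannot decrease.  If \<open>p\<close> does not change, the removed coordinate was below it, hence equal to \<open>i\<close>:
  the robber has moved below \<open>p\<close>.
\<close>

lemma card_damaged_match_first:
  assumes pos: "\<And>i. i < length ns \<Longrightarrow> 0 < ns ! i"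
    and \<rho>: "legal_robber (hamming ns) \<rho>"
  shows "card (damaged (match_first ns) \<rho>) \<le> (\<Sum>p\<in>{1..<length ns}. \<Prod>i<p. ns ! i)"
proof -
  let ?V = "pverts (hamming ns)"
  have legal_cop: "legal_cop (hamming ns) (match_first ns)"
    using pos by (rule legal_match_first)
  note legal = legal_cop \<rho>
  define c where "c = cop_at (match_first ns) \<rho>"
  define r where "r = robber_at (match_first ns) \<rho>"
  define E where "E t = differing (c (Suc t)) (r t)" for t
  have V: "c t \<in> ?V" "r t \<in> ?V" for t
    using play_in_verts[OF legal] by (simp_all add: c_def r_def)
  have len: "length (c t) = length ns" "length (r t) = length ns" for t
    using V[of t] by (simp_all add: pverts_hamming)
  have c_Suc: "c (Suc t) = (c t)[Min (differing (c t) (r t)) := r t ! Min (differing (c t) (r t))]" for t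
  proof -
    obtain h where "play (match_first ns) \<rho> t = (c t, r t) # h"
      using play_Cons unfolding c_def r_def by blast
    then have "c (Suc t) = match_first ns ((c t, r t) # h)"
      by (simp add: c_def cop_at_Suc)
    then show ?thesis
      using V(2)[of t] by (simp add: match_first_def Let_def)
  qed
  have E: "E t = differing (c t) (r t) - {Min (differing (c t) (r t))}" for t
    by (simp add: E_def c_Suc differing_list_update)
  have E_less: "E t \<subseteq> {..<length ns}" for t
    by (auto simp: E_def differing_def len)
  have finE: "finite (E t)" for t
    by (simp add: E_def finite_differing)
  have E_nonempty: "E t \<noteq> {}" if "\<not> captured_by (match_first ns) \<rho> (Suc t)" for t
    unfolding E_def using that len by (subst differing_empty_iff) (auto simp: captured_by_def c_def r_def)
  define p where "p t = Min (E t)" for t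
  define m where "m t = Min (differing (c t) (r t))" for t
  have p_in: "p t \<in> E t" if "\<not> captured_by (match_first ns) \<rho> (Suc t)" for t
    unfolding p_def by (rule Min_in[OF finE E_nonempty[OF that]])
  have p_le: "p t \<le> i" if "i \<in> E t" for i t
    unfolding p_def by (rule Min_le[OF finE that])
  have E_m: "E t = differing (c t) (r t) - {m t}" for t
    unfolding m_def by (rule E)
  have m_less: "m t < i" if "i \<in> E t" for i t
  proof -
    have i: "i \<in> differing (c t) (r t)" "i \<noteq> m t"
      using that by (simp_all add: E_m)
    have "m t \<le> i"
      unfolding m_def by (rule Min_le[OF finite_differing i(1)])
    with i(2) show ?thesis
      by simp
  qed
  have m_in: "m t \<in> differing (c t) (r t)" if "i \<in> differing (c t) (r t)" for i t
    unfolding m_def using that by (intro Min_in[OF finite_differing]) blast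
  show ?thesis
  proof (rule card_damaged_le_phases[where phase = p and free = "\<lambda>t. {..<p t}", OF legal])
    fix t
    assume nc': "\<not> captured_by (match_first ns) \<rho> (Suc (Suc t))"
    then have nc: "\<not> captured_by (match_first ns) \<rho> (Suc t)"
      using captured_by_mono by (meson le_SucI order_refl)
    let ?D = "differing (c (Suc t)) (r (Suc t))"
    obtain i where i: "\<forall>j<length ns. j \<noteq> i \<longrightarrow> r (Suc t) ! j = r t ! j"
      using robber_at_Suc_closed_nbhd[OF legal, of t] closed_nbhd_hamming_iff[OF V(2)[of t]]
      unfolding r_def by blast
    have D: "j \<in> ?D \<longleftrightarrow> j \<in> E t" if "j \<noteq> i" for j
      using i that by (auto simp: E_def differing_def len)
    have below: "j = i" if "j \<in> ?D" "j < p t" for j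
      using that D[of j] p_le[of j t] by fastforce
    have q: "p (Suc t) \<in> ?D"
      using p_in[OF nc'] E_m[of "Suc t"] by blast
    have m: "m (Suc t) \<in> ?D" "m (Suc t) < p (Suc t)"
      using m_in[OF q] m_less[OF p_in[OF nc']] by simp_all
    have le: "p t \<le> p (Suc t)"
      using below[OF q] below[OF m(1)] m(2) by fastforce
    have "i < p t" if "p (Suc t) = p t"
      using below[OF m(1)] m(2) that by simp
    with le i show "p t \<le> p (Suc t) \<and> (p (Suc t) = p t \<longrightarrow> {..<p (Suc t)} = {..<p t} \<and>
        (\<forall>j<length ns. j \<notin> {..<p t} \<longrightarrow>
          robber_at (match_first ns) \<rho> (Suc t) ! j = robber_at (match_first ns) \<rho> t ! j))"
      by (auto simp: r_def)
  next
    fix t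
    assume nc: "\<not> captured_by (match_first ns) \<rho> (Suc t)"
    have "0 < p t"
      using m_less[OF p_in[OF nc]] by simp
    moreover have "p t < length ns"
      using p_in[OF nc] E_less[of t] by blast
    ultimately show "p t \<in> {1..<length ns} \<and> {..<p t} \<subseteq> {..<length ns} \<and>
        (\<Prod>i\<in>{..<p t}. ns ! i) \<le> (\<Prod>i<p t. ns ! i)"
      by auto
  qed simp
qed

lemma dmg_hamming_le:
  assumes "\<And>i. i < length ns \<Longrightarrow> 0 < ns ! i"
  shows "dmg (hamming ns) \<le> (\<Sum>p\<in>{1..<length ns}. \<Prod>i<p. ns ! i)"
  using legal_match_first[of ns] card_damaged_match_first[of ns] assms
  by (intro dmg_le[OF finite_pverts_hamming, where \<sigma> = "match_first ns"]) blast+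

section \<open>A cop on the hypercube\<close>

text \<open>
  Histories start with the latest round, so \<open>snd (hd h')\<close> is the robber's position before his last
  move, and \<open>F\<close> contains the coordinate in
  which the cop agreed with the robber until that move spoiled it.  Undoing this has priority.
  Otherwise the cop gains a coordinate, but he passes when exactly two
  differ: copying one of them would give the robber a subcube of codimension one, whereas now he is
  caught as soon as he touches either of the two.
\<close>

definition rematch :: "nat list \<Rightarrow> nat list cop_strategy" where
  "rematch ns h = (case h of
      [] \<Rightarrow> replicate (length ns) 0
    | (c, r) # h' \<Rightarrow>
        let D = differing c r;
            F = {i \<in> D. h' \<noteq> [] \<and> c ! i = snd (hd h') ! i};
            K = (if F \<noteq> {} then F else if card D = 2 then {} else D)
        in if r \<in> pverts (hamming ns) \<and> K \<noteq> {} then c[Min K := r ! Min K] else c)"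

lemma legal_rematch:
  assumes "\<And>i. i < length ns \<Longrightarrow> 0 < ns ! i"
  shows "legal_cop (hamming ns) (rematch ns)"
proof -
  have "rematch ns ((c, r) # h) \<in> closed_nbhd (hamming ns) c"
    if c: "c \<in> pverts (hamming ns)" for c r h
  proof (cases "r \<in> pverts (hamming ns)")
    case True
    then have upd: "c[i := r ! i] \<in> closed_nbhd (hamming ns) c" for i
      by (intro list_update_closed_nbhd[OF c]) (simp add: pverts_hamming)
    have "c \<in> closed_nbhd (hamming ns) c"
      by (simp add: closed_nbhd_def)
    with True upd show ?thesis
      by (simp add: rematch_def Let_def)
  qed (simp add: rematch_def closed_nbhd_def)
  then show ?thesis
    using zero_in_hamming[OF assms] by (simp add: legal_cop_def rematch_def)
qed

text \<open>
  A single differing coordinate before the cop's move means that the cop captures, so \<open>E\<close> would be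
  empty.
\<close>

lemma two_le_card_unmatched:
  fixes D :: "nat set"
  assumes "finite D" "E = (if card D = 2 then D else D - {Min D})" "E \<noteq> {}"
  shows "2 \<le> card E"
proof (cases "card D = 2")
  case False
  then have E: "E = D - {Min D}"
    using assms(2) by simp
  then have "D \<noteq> {}"
    using assms(3) by blast
  then have "card E = card D - 1"
    unfolding E using assms(1) by (intro card_Diff_singleton Min_in)
  moreover have "card E \<noteq> 0"
    using assms(1,3) E by simp
  ultimately show ?thesis
    using False by linarith
qed (use assms(2) in simp)

text \<open>
  Again \<open>E t\<close> is the set of differing coordinates after the cop's move.  Either the robber changes a
  coordinate outside \<open>E t\<close>, the cop repairs it and \<open>E\<close> is unchanged; or no repair is due, and then
  \<open>E\<close> shrinks unless the robber passes with \<open>E t\<close> of size two.  The phase is the codimension of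
  the subcube, the number of coordinates outside \<open>E t\<close>.
\<close>

lemma card_damaged_rematch:
  assumes two: "\<And>i. i < length ns \<Longrightarrow> ns ! i = 2"
    and \<rho>: "legal_robber (hamming ns) \<rho>"
  shows "card (damaged (rematch ns) \<rho>) \<le> (\<Sum>p<length ns - 1. 2 ^ p)"
proof -
  have legal_cop: "legal_cop (hamming ns) (rematch ns)"
    using two by (intro legal_rematch) simp
  note legal = legal_cop \<rho>
  let ?V = "pverts (hamming ns)"
  define c where "c = cop_at (rematch ns) \<rho>"
  define r where "r = robber_at (rematch ns) \<rho>"
  define D where "D t = differing (c t) (r t)" for t
  define E where "E t = differing (c (Suc t)) (r t)" for t
  define F where "F t = {i \<in> D (Suc t). c (Suc t) ! i = r t ! i}" for t
  have V: "c t \<in> ?V" "r t \<in> ?V" for t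
    using play_in_verts[OF legal] by (simp_all add: c_def r_def)
  have len: "length (c t) = length ns" "length (r t) = length ns" for t
    using V[of t] by (simp_all add: pverts_hamming)
  have bit: "c t ! i < 2" "r t ! i < 2" if "i < length ns" for t i
    using V[of t] two that by (simp_all add: pverts_hamming)
  have in_D: "i \<in> D t \<longleftrightarrow> i < length ns \<and> c t ! i \<noteq> r t ! i" for i t
    by (simp add: D_def differing_def len)
  have in_E: "i \<in> E t \<longleftrightarrow> i < length ns \<and> c (Suc t) ! i \<noteq> r t ! i" for i t
    by (simp add: E_def differing_def len)
  have fin: "finite (D t)" "finite (E t)" for t
    by (simp_all add: D_def E_def finite_differing)
  have E_0: "E 0 = (if card (D 0) = 2 then D 0 else D 0 - {Min (D 0)})"
  proof -
    have "c 1 = rematch ns [(c 0, r 0)]"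
      by (simp add: c_def r_def cop_at_def robber_at_def Let_def)
    also have "\<dots> = (if card (D 0) = 2 \<or> D 0 = {} then c 0 else (c 0)[Min (D 0) := r 0 ! Min (D 0)])"
      using V(2)[of 0] by (simp add: rematch_def Let_def D_def)
    finally show ?thesis
      by (auto simp: E_def D_def differing_list_update)
  qed
  have E_Suc: "E (Suc t) = (if F t \<noteq> {} then D (Suc t) - {Min (F t)}
      else if card (D (Suc t)) = 2 then D (Suc t) else D (Suc t) - {Min (D (Suc t))})" for t
  proof -
    obtain h where h: "play (rematch ns) \<rho> t = (c t, r t) # h"
      using play_Cons unfolding c_def r_def by blast
    have "c (Suc (Suc t)) = rematch ns ((c (Suc t), r (Suc t)) # (c t, r t) # h)"
      unfolding c_def r_def cop_at_Suc[of _ _ "Suc t"] play_Suc_Cons h[unfolded c_def r_def] ..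
    also have "\<dots> = (if F t \<noteq> {} then (c (Suc t))[Min (F t) := r (Suc t) ! Min (F t)]
       else if card (D (Suc t)) = 2 \<or> D (Suc t) = {} then c (Suc t)
       else (c (Suc t))[Min (D (Suc t)) := r (Suc t) ! Min (D (Suc t))])"
    proof -
      have "{i \<in> differing (c (Suc t)) (r (Suc t)). c (Suc t) ! i = r t ! i} = F t"
        by (simp add: F_def D_def)
      then show ?thesis
        using V(2)[of "Suc t"]
        by (simp add: rematch_def Let_def D_def del: Collect_empty_eq empty_Collect_eq)
    qed
    finally show ?thesis
      by (auto simp: E_def D_def differing_list_update)
  qed
  have E_nonempty: "E t \<noteq> {}" if "\<not> captured_by (rematch ns) \<rho> (Suc t)" for t
    unfolding E_def using that len
    by (subst differing_empty_iff) (auto simp: captured_by_def c_def r_def)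
  have step: "E (Suc t) = E t \<and> (\<forall>j\<in>E t. r (Suc t) ! j = r t ! j) \<or>
      2 \<le> card (E (Suc t)) \<and> card (E (Suc t)) < card (E t)"
    if nc: "\<not> captured_by (rematch ns) \<rho> (Suc (Suc t))" for t
  proof -
    obtain i where i: "\<forall>j<length ns. j \<noteq> i \<longrightarrow> r (Suc t) ! j = r t ! j"
      using robber_at_Suc_closed_nbhd[OF legal, of t] closed_nbhd_hamming_iff[OF V(2)[of t]]
      unfolding r_def by blast
    show ?thesis
    proof (cases "F t = {}")
      case False
      have F_i: "j = i" if "j \<in> F t" for j
        using that i unfolding F_def in_D by force
      with False have F: "F t = {i}"
        by blast
      then have i_notin: "i \<notin> E t"
        unfolding F_def in_E by blast
      have "j \<in> D (Suc t) \<longleftrightarrow> j \<in> E t" if "j \<noteq> i" for j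
        using i that unfolding in_D in_E by auto
      then have "D (Suc t) - {i} = E t"
        using i_notin by (intro set_eqI) (metis DiffE DiffI singletonD singletonI)
      then have "E (Suc t) = E t"
        using E_Suc[of t] F by simp
      moreover have "r (Suc t) ! j = r t ! j" if "j \<in> E t" for j
        using i i_notin that unfolding in_E by metis
      ultimately show ?thesis
        by blast
    next
      case True
      then have E': "E (Suc t) = (if card (D (Suc t)) = 2 then D (Suc t) else D (Suc t) - {Min (D (Suc t))})"
        using E_Suc[of t] by simp
      have two_le: "2 \<le> card (E (Suc t))"
        by (rule two_le_card_unmatched[OF fin(1) E' E_nonempty[OF nc]])
      have sub: "E (Suc t) \<subseteq> D (Suc t)"
        using E' by auto
      have D_sub: "D (Suc t) \<subseteq> E t"
      proof
        fix j
        assume j: "j \<in> D (Suc t)"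
        with True have "c (Suc t) ! j \<noteq> r t ! j"
          unfolding F_def by blast
        with j show "j \<in> E t"
          unfolding in_D in_E by blast
      qed
      show ?thesis
      proof (cases "r (Suc t) = r t")
        case same: True
        then have D_eq: "D (Suc t) = E t"
          by (simp add: D_def E_def)
        show ?thesis
        proof (cases "card (D (Suc t)) = 2")
          case True
          then show ?thesis
            using E' D_eq same by simp
        next
          case False
          have "D (Suc t) \<noteq> {}"
            using sub E_nonempty[OF nc] by blast
          then have "Min (D (Suc t)) \<in> D (Suc t)"
            by (rule Min_in[OF fin(1)])
          then have "E (Suc t) \<subset> E t"
            using E' False D_eq by auto
          then show ?thesis
            using two_le psubset_card_mono[OF fin(2)] by blast
        qed
      next
        case False
        then obtain j where j: "j < length ns" "r (Suc t) ! j \<noteq> r t ! j"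
          using len by (metis nth_equalityI)
        have "c (Suc t) ! j \<noteq> r t ! j"
          using True j unfolding F_def in_D by auto
        \<comment> \<open>With only two values, leaving a value different from the cop's means taking the cop's.\<close>
        moreover from this have "c (Suc t) ! j = r (Suc t) ! j"
          using j bit(1)[of j "Suc t"] bit(2)[of j "Suc t"] bit(2)[of j t] by linarith
        ultimately have "j \<in> E t" "j \<notin> D (Suc t)"
          using j unfolding in_D in_E by simp_all
        then have "E (Suc t) \<subset> E t"
          using sub D_sub by blast
        then show ?thesis
          using two_le psubset_card_mono[OF fin(2)] by blast
      qed
    qed
  qed
  have two_le: "2 \<le> card (E t)" if "\<not> captured_by (rematch ns) \<rho> (Suc t)" for t
    using that
  proof (induction t)
    case 0
    then show ?case
      using two_le_card_unmatched[OF fin(1) E_0 E_nonempty] by blast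
  next
    case (Suc t)
    then have "\<not> captured_by (rematch ns) \<rho> (Suc t)"
      using captured_by_mono by (meson le_SucI order_refl)
    with Suc.IH step[OF Suc.prems] show ?case
      by auto
  qed
  have E_sub: "E t \<subseteq> {..<length ns}" for t
    using in_E by blast
  have card_E: "card (E t) \<le> length ns" for t
    using card_mono[OF _ E_sub[of t]] by simp
  have free: "(\<Prod>i\<in>{..<length ns} - E t. ns ! i) = 2 ^ (length ns - card (E t))" for t
  proof -
    have "(\<Prod>i\<in>{..<length ns} - E t. ns ! i) = (\<Prod>i\<in>{..<length ns} - E t. 2)"
      using two by (intro prod.cong) simp_all
    also have "\<dots> = 2 ^ (length ns - card (E t))"
      using E_sub[of t] fin(2)[of t] by (simp add: card_Diff_subset)
    finally show ?thesis .
  qed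
  show ?thesis
  proof (rule card_damaged_le_phases[where phase = "\<lambda>t. length ns - card (E t)"
        and free = "\<lambda>t. {..<length ns} - E t", OF legal])
    fix t
    assume "\<not> captured_by (rematch ns) \<rho> (Suc (Suc t))"
    from step[OF this] card_E[of t] show "length ns - card (E t) \<le> length ns - card (E (Suc t)) \<and>
      (length ns - card (E (Suc t)) = length ns - card (E t) \<longrightarrow>
        {..<length ns} - E (Suc t) = {..<length ns} - E t \<and>
        (\<forall>j<length ns. j \<notin> {..<length ns} - E t \<longrightarrow>
          robber_at (rematch ns) \<rho> (Suc t) ! j = robber_at (rematch ns) \<rho> t ! j))"
      unfolding r_def by auto
  next
    fix t
    assume "\<not> captured_by (rematch ns) \<rho> (Suc t)"
    from two_le[OF this] card_E[of t] free[of t]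
    show "length ns - card (E t) \<in> {..<length ns - 1} \<and> {..<length ns} - E t \<subseteq> {..<length ns} \<and>
      (\<Prod>i\<in>{..<length ns} - E t. ns ! i) \<le> 2 ^ (length ns - card (E t))"
      by auto
  qed simp
qed

lemma dmg_hypercube_le:
  assumes "\<And>i. i < length ns \<Longrightarrow> ns ! i = 2"
  shows "dmg (hamming ns) \<le> (\<Sum>p<length ns - 1. 2 ^ p)"
proof (rule dmg_le[OF finite_pverts_hamming])
  show "legal_cop (hamming ns) (rematch ns)"
    using assms by (intro legal_rematch) simp
qed (rule card_damaged_rematch[OF assms])

section \<open>A robber who cannot be confined\<close>

text \<open>
  The robber, about to move from \<open>r\<close> with the cop on \<open>c\<close> and \<open>A\<close> visited so far, can bring the
  number of visited vertices to \<open>k\<close> within \<open>m\<close> moves without ever ending a round within the cop's reach.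
  The number of moves is bounded so that a strategy can be read off: always move to a position from
  which one move less suffices.
\<close>

primrec robber_wins ::
    "'a pair_pre_digraph \<Rightarrow> nat \<Rightarrow> nat \<Rightarrow> 'a \<Rightarrow> 'a \<Rightarrow> 'a set \<Rightarrow> bool" where
  "robber_wins G k 0 c r A \<longleftrightarrow> k \<le> card A"
| "robber_wins G k (Suc m) c r A \<longleftrightarrow> k \<le> card A \<or>
     (\<exists>r'\<in>closed_nbhd G r - closed_nbhd G c.
        \<forall>c'\<in>closed_nbhd G c. robber_wins G k m c' r' (insert r' A))"

lemma robber_wins_Suc: "robber_wins G k m c r A \<Longrightarrow> robber_wins G k (Suc m) c r A"
proof (induction m arbitrary: c r A)
  case (Suc m)
  then have "k \<le> card A \<or> (\<exists>r'\<in>closed_nbhd G r - closed_nbhd G c.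
      \<forall>c'\<in>closed_nbhd G c. robber_wins G k m c' r' (insert r' A))"
    by simp
  then show ?case
    using Suc.IH by (subst robber_wins.simps) blast
qed simp

lemma robber_wins_mono:
  assumes "robber_wins G k m c r A" "m \<le> m'"
  shows "robber_wins G k m' c r A"
  using assms(2,1) by (induction m' rule: dec_induct) (blast intro: robber_wins_Suc)+

lemma uniform_bound:
  fixes P :: "nat \<Rightarrow> 'a \<Rightarrow> bool"
  assumes "finite S" "\<And>x. x \<in> S \<Longrightarrow> \<exists>m. P m x" "\<And>x m m'. P m x \<Longrightarrow> m \<le> m' \<Longrightarrow> P m' x"
  shows "\<exists>m. \<forall>x\<in>S. P m x"
proof -
  obtain f where f: "\<And>x. x \<in> S \<Longrightarrow> P (f x) x"
    using assms(2) by metis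
  have "P (Max (f ` S)) x" if "x \<in> S" for x
    using assms(1) that by (intro assms(3)[OF f]) auto
  then show ?thesis
    by blast
qed

lemma finite_closed_nbhd: "finite (pverts G) \<Longrightarrow> finite (closed_nbhd G c)"
  by (simp add: closed_nbhd_def)

lemma self_in_closed_nbhd: "c \<in> closed_nbhd G c"
  by (simp add: closed_nbhd_def)

text \<open>
  A set in which a cop might hold the robber forever.  The cop positions for different vertices of
  \<open>R\<close> are unrelated: whether the cop can reach one from another is not asked, since already this local
  condition forces \<open>R\<close> to be large.
\<close>

definition confinement :: "'a pair_pre_digraph \<Rightarrow> 'a set \<Rightarrow> bool" where
  "confinement G R \<longleftrightarrow> R \<subseteq> pverts G \<and>
     (\<forall>r\<in>R. \<exists>c\<in>pverts G. c \<noteq> r \<and> closed_nbhd G r - closed_nbhd G c \<subseteq> R)"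

text \<open>
  Call a state stuck if the robber does not win from it in any number of moves, and
  choose one with a maximal set \<open>B\<close> of visited vertices.  From a stuck state each safe move of the robber has an
  answer leading to a stuck state again: otherwise each of the finitely many answers loses to some number of
  moves, and the largest of these numbers works for all.  By maximality the safe move has stayed in \<open>B\<close>.
  So the positions of the robber in stuck states with visited set \<open>B\<close> form a confinement inside \<open>B\<close>.
\<close>

lemma robber_wins_unless_confined:
  assumes fin: "finite (pverts G)"
    and confined: "\<And>R. confinement G R \<Longrightarrow> R \<noteq> {} \<Longrightarrow> k \<le> card R"
    and start: "c \<in> pverts G" "r \<in> pverts G" "c \<noteq> r" "r \<in> A" "A \<subseteq> pverts G"
  shows "\<exists>m. robber_wins G k m c r A"
proof (rule ccontr)
  define stuck where "stuck c r A \<longleftrightarrow> c \<in> pverts G \<and> r \<in> pverts G \<and> c \<noteq> r \<and> r \<in> A \<and>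
    A \<subseteq> pverts G \<and> (\<forall>m. \<not> robber_wins G k m c r A)" for c r A
  define X where "X = {A. \<exists>c r. stuck c r A}"
  assume "\<not> ?thesis"
  then have "stuck c r A"
    using start by (simp add: stuck_def)
  then have "X \<noteq> {}"
    unfolding X_def by blast
  moreover have "X \<subseteq> Pow (pverts G)"
    by (auto simp: X_def stuck_def)
  then have "finite X"
    by (rule finite_subset) (simp add: fin)
  ultimately obtain B where B: "B \<in> X" "\<And>A. A \<in> X \<Longrightarrow> B \<subseteq> A \<Longrightarrow> B = A"
    using finite_has_maximal[of X] by metis
  define R where "R = {r. \<exists>c. stuck c r B}"
  have "k \<le> card R"
  proof (rule confined)
    show "R \<noteq> {}"
      using B(1) by (auto simp: R_def X_def)
    show "confinement G R"
      unfolding confinement_def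
    proof (intro conjI ballI)
      show "R \<subseteq> pverts G"
        by (auto simp: R_def stuck_def)
    next
      fix r
      assume "r \<in> R"
      then obtain c where c: "stuck c r B"
        by (auto simp: R_def)
      have "r' \<in> R" if r': "r' \<in> closed_nbhd G r" "r' \<notin> closed_nbhd G c" for r'
      proof -
        have "\<exists>c'\<in>closed_nbhd G c. \<forall>m. \<not> robber_wins G k m c' r' (insert r' B)"
        proof (rule ccontr)
          assume "\<not> ?thesis"
          then have "\<exists>m. robber_wins G k m c' r' (insert r' B)" if "c' \<in> closed_nbhd G c" for c'
            using that by blast
          then have "\<exists>m. \<forall>c'\<in>closed_nbhd G c. robber_wins G k m c' r' (insert r' B)"
            by (rule uniform_bound[where P = "\<lambda>m c'. robber_wins G k m c' r' (insert r' B)",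
                  OF finite_closed_nbhd[OF fin]]) (assumption, rule robber_wins_mono)
          then obtain m where "\<forall>c'\<in>closed_nbhd G c. robber_wins G k m c' r' (insert r' B)" ..
          then have "robber_wins G k (Suc m) c r B"
            using r' by auto
          with c show False
            unfolding stuck_def by blast
        qed
        then obtain c' where c': "c' \<in> closed_nbhd G c"
          "\<forall>m. \<not> robber_wins G k m c' r' (insert r' B)"
          by blast
        have V: "c \<in> pverts G" "r \<in> pverts G" "B \<subseteq> pverts G"
          using c by (simp_all add: stuck_def)
        have "c' \<in> pverts G" "r' \<in> pverts G"
          using subsetD[OF closed_nbhd_subset[OF V(1)] c'(1)] subsetD[OF closed_nbhd_subset[OF V(2)] r'(1)]
          by simp_all
        moreover have "c' \<noteq> r'"
          using c'(1) r'(2) by blast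
        ultimately have stuck': "stuck c' r' (insert r' B)"
          using c'(2) V(3) by (simp add: stuck_def)
        then have "insert r' B \<in> X"
          unfolding X_def by blast
        then have "B = insert r' B"
          using B(2) by blast
        with stuck' have "stuck c' r' B"
          by simp
        then show "r' \<in> R"
          unfolding R_def by blast
      qed
      with c show "\<exists>c\<in>pverts G. c \<noteq> r \<and> closed_nbhd G r - closed_nbhd G c \<subseteq> R"
        unfolding stuck_def by blast
    qed
  qed
  also have "R \<subseteq> B"
    by (auto simp: R_def stuck_def)
  then have "card R \<le> card B"
    using B(1) fin by (intro card_mono) (auto simp: X_def stuck_def dest: finite_subset)
  finally have "robber_wins G k 0 c r B" for c r
    by simp
  with B(1) show False
    unfolding X_def stuck_def by blast
qed

text \<open>
  The robber plans for a fixed horizon \<open>T\<close>.  The length of the history is the number of rounds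
  played so far including the placement; since the placement uses up none of the \<open>T\<close> moves, \<open>T - length h\<close> moves
  remain after the one to be chosen now.  Once \<open>k\<close> vertices are visited he stays where he is; the first such
  pass ensures that also his current vertex becomes damaged.
\<close>

definition roam :: "'a pair_pre_digraph \<Rightarrow> nat \<Rightarrow> nat \<Rightarrow> 'a robber_strategy" where
  "roam G k T h c = (case h of
      [] \<Rightarrow> (if c \<in> pverts G then SOME r. r \<in> pverts G \<and> r \<notin> closed_nbhd G c
             else SOME r. r \<in> pverts G)
    | (_, r) # _ \<Rightarrow>
        let A = snd ` set h;
            good = (\<lambda>r'. r' \<in> closed_nbhd G r - closed_nbhd G c \<and>
              (\<forall>c'\<in>closed_nbhd G c. robber_wins G k (T - length h) c' r' (insert r' A)))
        in if card A < k \<and> (\<exists>r'. good r') then SOME r'. good r' else r)"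

lemma length_play: "length (play \<sigma> \<rho> t) = Suc t"
  by (induction t) (simp_all add: Let_def)

lemma robber_visits: "snd ` set (play \<sigma> \<rho> t) = robber_at \<sigma> \<rho> ` {..t}"
proof (induction t)
  case 0
  then show ?case
    by (simp add: robber_at_def)
next
  case (Suc t)
  then show ?case
    by (simp add: play_Suc_Cons atMost_Suc del: play.simps)
qed

text \<open>
  While fewer than \<open>k\<close> vertices are visited, the strategy \<^const>\<open>roam\<close> keeps a state won within the
  remaining moves, and every round ends out of the cop's reach, so that each visited vertex becomes
  damaged.
\<close>

lemma can_guarantee_unless_confined:
  assumes fin: "finite (pverts G)" and nonempty: "pverts G \<noteq> {}"
    and far: "\<And>c. c \<in> pverts G \<Longrightarrow> \<exists>r\<in>pverts G. r \<notin> closed_nbhd G c"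
    and confined: "\<And>R. confinement G R \<Longrightarrow> R \<noteq> {} \<Longrightarrow> k \<le> card R"
  shows "can_guarantee G k"
proof -
  have "\<exists>T. \<forall>x\<in>{(c, r). c \<in> pverts G \<and> r \<in> pverts G \<and> c \<noteq> r}.
      (case x of (c, r) \<Rightarrow> robber_wins G k T c r {r})"
  proof (rule uniform_bound[where P = "\<lambda>m x. case x of (c, r) \<Rightarrow> robber_wins G k m c r {r}"])
    show "finite {(c, r). c \<in> pverts G \<and> r \<in> pverts G \<and> c \<noteq> r}"
      by (rule finite_subset[OF _ finite_cartesian_product[OF fin fin]]) auto
  next
    fix x
    assume "x \<in> {(c, r). c \<in> pverts G \<and> r \<in> pverts G \<and> c \<noteq> r}"
    then obtain c r where "x = (c, r)" "c \<in> pverts G" "r \<in> pverts G" "c \<noteq> r"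
      by blast
    then show "\<exists>m. (case x of (c, r) \<Rightarrow> robber_wins G k m c r {r})"
      using robber_wins_unless_confined[OF fin, of k c r "{r}"] confined by simp
  qed (auto intro: robber_wins_mono)
  then obtain T where T: "\<And>c r. c \<in> pverts G \<Longrightarrow> r \<in> pverts G \<Longrightarrow> c \<noteq> r \<Longrightarrow> robber_wins G k T c r {r}"
    by blast
  define \<rho> where "\<rho> = roam G k T"
  have first: "\<rho> [] c \<in> pverts G \<and> \<rho> [] c \<notin> closed_nbhd G c" if "c \<in> pverts G" for c
    using someI_ex[OF far[OF that, unfolded Bex_def]] that by (simp add: \<rho>_def roam_def)
  have legal_robber: "legal_robber G \<rho>"
    unfolding legal_robber_def
  proof (intro conjI allI ballI)
    fix c
    show "\<rho> [] c \<in> pverts G"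
    proof (cases "c \<in> pverts G")
      case False
      then show ?thesis
        using nonempty by (simp add: \<rho>_def roam_def some_in_eq)
    qed (use first in blast)
  next
    fix r c c' :: 'a and h
    define good where "good r' \<longleftrightarrow> r' \<in> closed_nbhd G r - closed_nbhd G c' \<and>
      (\<forall>c''\<in>closed_nbhd G c'. robber_wins G k (T - length ((c, r) # h)) c'' r'
         (insert r' (snd ` set ((c, r) # h))))" for r'
    have "\<rho> ((c, r) # h) c' =
        (if card (snd ` set ((c, r) # h)) < k \<and> (\<exists>r'. good r') then SOME r'. good r' else r)"
      unfolding \<rho>_def roam_def good_def Let_def by simp
    moreover have "(SOME r'. good r') \<in> closed_nbhd G r" if "\<exists>r'. good r'"
      using someI_ex[OF that] unfolding good_def by blast
    ultimately show "\<rho> ((c, r) # h) c' \<in> closed_nbhd G r"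
      using self_in_closed_nbhd[of r G] by simp
  qed
  have "k \<le> card (damaged \<sigma> \<rho>)" if legal_cop: "legal_cop G \<sigma>" for \<sigma>
  proof -
    note legal = legal_cop legal_robber
    define c where "c = cop_at \<sigma> \<rho>"
    define r where "r = robber_at \<sigma> \<rho>"
    define A where "A t = r ` {..t}" for t
    have c_Suc: "c (Suc t) \<in> closed_nbhd G (c t)" for t
      unfolding c_def by (rule cop_at_Suc_closed_nbhd[OF legal])
    have V: "c t \<in> pverts G" "r t \<in> pverts G" for t
      using play_in_verts[OF legal] by (simp_all add: c_def r_def)
    have A_Suc: "A (Suc t) = insert (r (Suc t)) (A t)" for t
      by (simp add: A_def atMost_Suc)
    define good where "good t r' \<longleftrightarrow> r' \<in> closed_nbhd G (r t) - closed_nbhd G (c (Suc t)) \<and>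
      (\<forall>c'\<in>closed_nbhd G (c (Suc t)). robber_wins G k (T - Suc t) c' r' (insert r' (A t)))" for t r'
    have r_Suc: "r (Suc t) =
        (if card (A t) < k \<and> (\<exists>r'. good t r') then SOME r'. good t r' else r t)" for t
    proof -
      obtain h where h: "play \<sigma> \<rho> t = (c t, r t) # h"
        using play_Cons unfolding c_def r_def by blast
      have "snd ` set ((c t, r t) # h) = A t" "length ((c t, r t) # h) = Suc t"
        using robber_visits[of \<sigma> \<rho> t] length_play[of \<sigma> \<rho> t] by (simp_all only: h A_def r_def)
      then have "roam G k T ((c t, r t) # h) (c (Suc t)) =
          (if card (A t) < k \<and> (\<exists>r'. good t r') then SOME r'. good t r' else r t)"
        unfolding roam_def good_def Let_def by (simp only: list.case prod.case)
      then show ?thesis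
        unfolding r_def robber_at_Suc[of \<sigma> \<rho> t] h[unfolded r_def] by (simp add: \<rho>_def c_def)
    qed
    have safe: "r 0 \<notin> closed_nbhd G (c 0)"
      using first legal_cop by (simp add: r_def c_def robber_at_def cop_at_def legal_cop_def)
    have progress: "(\<exists>s\<le>t. k \<le> card (A s) \<and> (\<forall>i\<le>s. r i \<notin> closed_nbhd G (c i))) \<or>
        (\<forall>i\<le>t. r i \<notin> closed_nbhd G (c i)) \<and>
        (\<forall>c'\<in>closed_nbhd G (c t). robber_wins G k (T - t) c' (r t) (A t))"
      if "t \<le> T" for t
      using that
    proof (induction t)
      case 0
      have "robber_wins G k T c' (r 0) {r 0}" if "c' \<in> closed_nbhd G (c 0)" for c'
        using that safe V closed_nbhd_subset[OF V(1)] by (intro T) auto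
      with safe show ?case
        by (simp add: A_def)
    next
      case (Suc t)
      show ?case
      proof (cases "\<exists>s\<le>t. k \<le> card (A s) \<and> (\<forall>i\<le>s. r i \<notin> closed_nbhd G (c i))")
        case True
        then show ?thesis
          using le_SucI by blast
      next
        case False
        with Suc have safe_t: "\<forall>i\<le>t. r i \<notin> closed_nbhd G (c i)"
          and "robber_wins G k (T - t) (c (Suc t)) (r t) (A t)"
          using c_Suc by auto
        moreover have "T - t = Suc (T - Suc t)"
          using Suc.prems by simp
        ultimately have "k \<le> card (A t) \<or> (\<exists>r'. good t r')"
          unfolding good_def by (auto simp del: T)
        moreover have "card (A t) < k"
          using False safe_t by (meson not_le order_refl)
        ultimately have "good t (r (Suc t))"
          unfolding r_Suc by (simp add: someI_ex)
        then show ?thesis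
          unfolding good_def A_Suc using safe_t le_Suc_eq by auto
      qed
    qed
    have "\<exists>s\<le>T. k \<le> card (A s) \<and> (\<forall>i\<le>s. r i \<notin> closed_nbhd G (c i))"
      using progress[of T] self_in_closed_nbhd[of "c T" G] by auto
    then obtain s where s: "k \<le> card (A s)" "\<And>i. i \<le> s \<Longrightarrow> r i \<notin> closed_nbhd G (c i)"
      by blast
    have caught: "c (Suc i) \<noteq> r i" "c i \<noteq> r i" if "i \<le> s" for i
      using s(2)[OF that] c_Suc[of i] self_in_closed_nbhd[of "c i" G] by auto
    have "r (Suc s) = r s"
      using s(1) by (simp add: r_Suc)
    then have caught_Suc: "c i \<noteq> r i" if "i \<le> Suc s" for i
      using that caught by (metis le_Suc_eq order_refl)
    have free: "\<not> captured_by \<sigma> \<rho> (Suc s)"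
      using caught caught_Suc unfolding captured_by_def c_def r_def by (metis less_Suc_eq_le)
    have "A s \<subseteq> damaged \<sigma> \<rho>"
    proof
      fix x
      assume "x \<in> A s"
      then obtain i where i: "i \<le> s" "x = r i"
        by (auto simp: A_def)
      with free have "\<not> captured_by \<sigma> \<rho> (Suc i)"
        using captured_by_mono Suc_le_mono by blast
      with i show "x \<in> damaged \<sigma> \<rho>"
        by (auto simp: damaged_def r_def)
    qed
    then have "card (A s) \<le> card (damaged \<sigma> \<rho>)"
      by (intro card_mono finite_subset[OF damaged_subset_pverts[OF legal] fin])
    with s(1) show ?thesis
      by simp
  qed
  with legal_robber show ?thesis
    unfolding can_guarantee_def by blast
qed

section \<open>Confinements of a Hamming graph are large\<close>

text \<open>
  The two ways in which a cop can block a robber on \<open>r\<close>: adjacent to him, along all of one direction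
  \<open>j\<close>; or further away, at single vertices in at most two directions.  The set \<open>I\<close> of directions taken
  into account shrinks when a set is cut into slices.
\<close>

definition almost_full :: "(nat \<Rightarrow> nat) \<Rightarrow> nat set \<Rightarrow> nat list set \<Rightarrow> nat list \<Rightarrow> bool" where
  "almost_full n I R r \<longleftrightarrow>
     (\<exists>j. \<forall>i\<in>I - {j}. \<forall>x<n i. r[i := x] \<in> R) \<or>
     (\<exists>j k y z. \<forall>i\<in>I. \<forall>x<n i. r[i := x] \<notin> R \<longrightarrow> i = j \<and> x = y \<or> i = k \<and> x = z)"

text \<open>
  A neighbour of \<open>r\<close> that differs from \<open>c\<close> in two coordinates is out of the cop's reach.  If \<open>r\<close> and \<open>c\<close>
  differ in \<open>j\<close> and \<open>k\<close>, then only two neighbours of \<open>r\<close> can fail to differ from \<open>c\<close> in both \<open>j\<close>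
  and \<open>k\<close>, those that copy one of the two coordinates.  If they
  differ in \<open>j\<close> alone, every change of another coordinate creates a second difference.
\<close>

lemma almost_full_confinement:
  assumes R: "confinement (hamming ns) R" and r: "r \<in> R"
  shows "almost_full ((!) ns) {..<length ns} R r"
proof -
  obtain c where c: "c \<in> pverts (hamming ns)" "c \<noteq> r"
    "closed_nbhd (hamming ns) r - closed_nbhd (hamming ns) c \<subseteq> R"
    using R r unfolding confinement_def by blast
  have rV: "r \<in> pverts (hamming ns)"
    using R r unfolding confinement_def by blast
  have len: "length c = length ns" "length r = length ns"
    using c(1) rV by (simp_all add: pverts_hamming)
  have in_R: "r[i := x] \<in> R"
    if "i < length ns" "x < ns ! i" "j < length ns" "k < length ns" "j \<noteq> k"
      "r[i := x] ! j \<noteq> c ! j" "r[i := x] ! k \<noteq> c ! k" for i x j k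
  proof -
    have "r[i := x] \<in> closed_nbhd (hamming ns) r"
      by (rule list_update_closed_nbhd[OF rV that(2)])
    moreover have "r[i := x] \<notin> closed_nbhd (hamming ns) c"
      unfolding closed_nbhd_hamming_iff[OF c(1)] using that by metis
    ultimately show ?thesis
      using c(3) by blast
  qed
  obtain j where j: "j < length ns" "r ! j \<noteq> c ! j"
    using c(2) len by (metis nth_equalityI)
  show ?thesis
  proof (cases "\<exists>k<length ns. k \<noteq> j \<and> r ! k \<noteq> c ! k")
    case True
    then obtain k where k: "k < length ns" "k \<noteq> j" "r ! k \<noteq> c ! k"
      by blast
    have "i = j \<and> x = c ! j \<or> i = k \<and> x = c ! k"
      if i: "i < length ns" "x < ns ! i" "r[i := x] \<notin> R" for i x
    proof (rule ccontr)
      assume "\<not> ?thesis"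
      then have "r[i := x] ! j \<noteq> c ! j" "r[i := x] ! k \<noteq> c ! k"
        using j k i(1) len by (auto simp: nth_list_update)
      with in_R[OF i(1,2) j(1) k(1)] k(2) i(3) show False
        by simp
    qed
    then show ?thesis
      unfolding almost_full_def by (metis lessThan_iff)
  next
    case False
    have "r[i := x] \<in> R" if i: "i < length ns" "i \<noteq> j" "x < ns ! i" for i x
    proof (cases "x = r ! i")
      case True
      then show ?thesis
        using r by simp
    next
      case x: False
      have "r[i := x] ! j \<noteq> c ! j" "r[i := x] ! i \<noteq> c ! i"
        using i j x False len by auto
      then show ?thesis
        using in_R[OF i(1,3) j(1) i(1)] i(2) by simp
    qed
    then show ?thesis
      unfolding almost_full_def by (metis DiffE lessThan_iff singletonI)
  qed
qed

lemma sum_card_fibres_le: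
  assumes "finite X" "finite R"
  shows "(\<Sum>x\<in>X. card {r \<in> R. f r = x}) \<le> card R"
proof -
  have "(\<Sum>x\<in>X. card {r \<in> R. f r = x}) = card (\<Union>x\<in>X. {r \<in> R. f r = x})"
    using assms by (intro card_UN_disjoint[symmetric]) auto
  also have "\<dots> \<le> card R"
    using assms(2) by (intro card_mono) auto
  finally show ?thesis .
qed

text \<open>The case of two factors equal to \<open>2\<close> is the reason for the denominator \<open>4\<close>.\<close>

lemma mult_le_pred_mult_pred:
  fixes a b N :: nat
  assumes "2 \<le> a" "2 \<le> b" "a \<le> N" "b \<le> N" "a = 2 \<Longrightarrow> b = 2 \<Longrightarrow> 4 \<le> N"
  shows "a * b \<le> (a - 1) * (b - 1) * N"
proof (cases "a = 2")
  case a: True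
  show ?thesis
  proof (cases "b = 2")
    case False
    then have "2 * b \<le> (b - 1) * N"
      using assms by (intro mult_mono) simp_all
    with a show ?thesis
      by simp
  qed (use a assms in simp)
next
  case False
  have "b \<le> 2 * (b - 1)"
    using assms(2) by linarith
  also have "\<dots> \<le> (a - 1) * (b - 1)"
    using False assms(1) by (intro mult_right_mono) simp_all
  finally have "b * a \<le> (a - 1) * (b - 1) * N"
    using assms(3) by (rule mult_mono) simp_all
  then show ?thesis
    by (simp add: mult.commute)
qed

text \<open>
  If \<open>R\<close> contains a whole line in direction \<open>e\<close>, then all \<open>n e\<close> slices of \<open>R\<close> across \<open>e\<close> are nonempty,
  and they are almost full in the remaining directions with the same bound \<open>N\<close>.  If \<open>R\<close> contains no whole line,
  at most two directions are left, and when there are two, \<open>a\<close> and \<open>b\<close>, exactly one vertex is missing from each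
  line through each vertex of \<open>R\<close>.  So \<open>R\<close> has at least \<open>(n a - 1) * (n b - 1)\<close> elements.
\<close>

lemma card_almost_full:
  fixes n :: "nat \<Rightarrow> nat" and R :: "nat list set"
  assumes "finite I" "finite R" "R \<noteq> {}"
    and "\<And>r. r \<in> R \<Longrightarrow> almost_full n I R r"
    and "\<And>r i. r \<in> R \<Longrightarrow> i \<in> I \<Longrightarrow> i < length r"
    and "\<And>i. i \<in> I \<Longrightarrow> 2 \<le> n i" "\<And>i. i \<in> I \<Longrightarrow> n i \<le> N" "0 < N"
    and "\<And>i j. i \<in> I \<Longrightarrow> j \<in> I \<Longrightarrow> i \<noteq> j \<Longrightarrow> n i = 2 \<Longrightarrow> n j = 2 \<Longrightarrow> 4 \<le> N"
  shows "(\<Prod>i\<in>I. n i) \<le> card R * N"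
  using assms
proof (induction I arbitrary: R rule: finite_psubset_induct)
  case (psubset I)
  note full = psubset.prems(3) and len = psubset.prems(4) and two = psubset.prems(5)
    and le_N = psubset.prems(6) and four = psubset.prems(8)
  have R_pos: "0 < card R"
    using psubset.prems(1,2) by (simp add: card_gt_0_iff)
  show ?case
  proof (cases "\<exists>r\<in>R. \<exists>e\<in>I. \<forall>x<n e. r[e := x] \<in> R")
    case True
    then obtain r e where r: "r \<in> R" "e \<in> I" "\<And>x. x < n e \<Longrightarrow> r[e := x] \<in> R"
      by blast
    let ?S = "\<lambda>x. {r \<in> R. r ! e = x}"
    have slice: "(\<Prod>i\<in>I - {e}. n i) \<le> card (?S x) * N" if "x < n e" for x
    proof (rule psubset.IH)
      show "I - {e} \<subset> I"
        using r(2) by blast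
      show "finite (?S x)"
        using psubset.prems(1) by simp
      have "r[e := x] ! e = x"
        using len[OF r(1,2)] by simp
      then show "?S x \<noteq> {}"
        using r(3)[OF that] by blast
      show "almost_full n (I - {e}) (?S x) s" if "s \<in> ?S x" for s
      proof -
        have s: "s \<in> R" "s ! e = x"
          using that by simp_all
        have in_S: "s[i := y] \<in> ?S x \<longleftrightarrow> s[i := y] \<in> R" if "i \<in> I - {e}" for i y
          using that s(2) by simp
        show ?thesis
          using full[OF s(1)] unfolding almost_full_def
        proof (elim disjE exE)
          fix j
          assume "\<forall>i\<in>I - {j}. \<forall>y<n i. s[i := y] \<in> R"
          then have "\<forall>i\<in>I - {e} - {j}. \<forall>y<n i. s[i := y] \<in> ?S x"
            using in_S by blast
          then show "(\<exists>j. \<forall>i\<in>I - {e} - {j}. \<forall>y<n i. s[i := y] \<in> ?S x) \<or>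
              (\<exists>j k u v. \<forall>i\<in>I - {e}. \<forall>y<n i. s[i := y] \<notin> ?S x \<longrightarrow> i = j \<and> y = u \<or> i = k \<and> y = v)"
            by blast
        next
          fix j k u v
          assume "\<forall>i\<in>I. \<forall>y<n i. s[i := y] \<notin> R \<longrightarrow> i = j \<and> y = u \<or> i = k \<and> y = v"
          then have "\<forall>i\<in>I - {e}. \<forall>y<n i. s[i := y] \<notin> ?S x \<longrightarrow> i = j \<and> y = u \<or> i = k \<and> y = v"
            using in_S by blast
          then show "(\<exists>j. \<forall>i\<in>I - {e} - {j}. \<forall>y<n i. s[i := y] \<in> ?S x) \<or>
              (\<exists>j k u v. \<forall>i\<in>I - {e}. \<forall>y<n i. s[i := y] \<notin> ?S x \<longrightarrow> i = j \<and> y = u \<or> i = k \<and> y = v)"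
            by blast
        qed
      qed
    qed (use len two le_N psubset.prems(7) four in auto)
    have "(\<Prod>i\<in>I. n i) = (\<Sum>x<n e. \<Prod>i\<in>I - {e}. n i)"
      using psubset.hyps r(2) by (simp add: prod.remove)
    also have "\<dots> \<le> (\<Sum>x<n e. card (?S x) * N)"
      using slice by (intro sum_mono) simp
    also have "\<dots> = (\<Sum>x<n e. card (?S x)) * N"
      by (simp add: sum_distrib_right)
    also have "\<dots> \<le> card R * N"
      using psubset.prems(1) by (intro mult_right_mono sum_card_fibres_le) simp_all
    finally show ?thesis .
  next
    case no_line: False
    show ?thesis
    proof (cases "\<exists>j. I \<subseteq> {j}")
      case True
      then obtain j where "I \<subseteq> {j}" by blast
      then have "(\<Prod>i\<in>I. n i) \<le> N"
        using le_N[of j] psubset.prems(7) by (cases "j \<in> I") (auto simp: subset_singleton_iff)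
      also have "\<dots> \<le> card R * N"
        using R_pos by (cases "card R") simp_all
      finally show ?thesis .
    next
      case False
      have gap: "\<exists>j k y z. I \<subseteq> {j, k} \<and>
          (\<forall>i\<in>I. \<forall>x<n i. s[i := x] \<notin> R \<longrightarrow> i = j \<and> x = y \<or> i = k \<and> x = z)" if s: "s \<in> R" for s
        using full[OF s] unfolding almost_full_def
      proof
        assume "\<exists>j. \<forall>i\<in>I - {j}. \<forall>x<n i. s[i := x] \<in> R"
        then have False
          using no_line s False by blast
        then show ?thesis ..
      next
        assume "\<exists>j k y z. \<forall>i\<in>I. \<forall>x<n i. s[i := x] \<notin> R \<longrightarrow> i = j \<and> x = y \<or> i = k \<and> x = z"
        then obtain j k y z where
          jk: "\<forall>i\<in>I. \<forall>x<n i. s[i := x] \<notin> R \<longrightarrow> i = j \<and> x = y \<or> i = k \<and> x = z"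
          by blast
        moreover have "I \<subseteq> {j, k}"
          using no_line s jk by blast
        ultimately show ?thesis
          by blast
      qed
      obtain r where r: "r \<in> R"
        using psubset.prems(2) by blast
      from gap[OF r] obtain a b where "I \<subseteq> {a, b}"
        by blast
      with False have I: "I = {a, b}" "a \<noteq> b"
        by blast+
      have one_gap: "\<exists>y. \<forall>x<n i. s[i := x] \<notin> R \<longrightarrow> x = y" if s: "s \<in> R" and i: "i \<in> I" for s i
      proof -
        obtain j k y z where jk: "I \<subseteq> {j, k}"
          "\<forall>i\<in>I. \<forall>x<n i. s[i := x] \<notin> R \<longrightarrow> i = j \<and> x = y \<or> i = k \<and> x = z"
          using gap[OF s] by blast
        then have "j \<noteq> k"
          using False by auto
        with jk(2) i show ?thesis
          by metis
      qed
      have line: "n i - 1 \<le> card {x. x < n i \<and> s[i := x] \<in> R}" if s: "s \<in> R" "i \<in> I" for s i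
      proof -
        obtain y where "\<forall>x<n i. s[i := x] \<notin> R \<longrightarrow> x = y"
          using one_gap[OF s] by blast
        then have "{..<n i} - {y} \<subseteq> {x. x < n i \<and> s[i := x] \<in> R}"
          by auto
        then have "card ({..<n i} - {y}) \<le> card {x. x < n i \<and> s[i := x] \<in> R}"
          by (intro card_mono) simp_all
        moreover have "n i - 1 \<le> card ({..<n i} - {y})"
          by (simp add: card_Diff_singleton_if)
        ultimately show ?thesis
          by simp
      qed
      let ?X = "{x. x < n a \<and> r[a := x] \<in> R}"
      have slice: "n b - 1 \<le> card {s \<in> R. s ! a = x}" if x: "x \<in> ?X" for x
      proof -
        let ?Y = "{y. y < n b \<and> r[a := x, b := y] \<in> R}"
        have lt: "a < length r" "b < length r"
          using len[OF r] I by simp_all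
        have "inj_on (\<lambda>y. r[a := x, b := y]) ?Y"
          using lt by (intro inj_onI) (metis length_list_update nth_list_update_eq)
        then have "card ?Y = card ((\<lambda>y. r[a := x, b := y]) ` ?Y)"
          by (simp add: card_image)
        also have "\<dots> \<le> card {s \<in> R. s ! a = x}"
          using lt I(2) psubset.prems(1) by (intro card_mono) auto
        finally show ?thesis
          using line[of "r[a := x]" b] x I(1) by simp
      qed
      have "(n a - 1) * (n b - 1) \<le> card ?X * (n b - 1)"
        using line[OF r, of a] I(1) by (intro mult_right_mono) simp_all
      also have "\<dots> = (\<Sum>x\<in>?X. n b - 1)"
        by simp
      also have "\<dots> \<le> (\<Sum>x\<in>?X. card {s \<in> R. s ! a = x})"
        using slice by (intro sum_mono)
      also have "\<dots> \<le> card R"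
        using psubset.prems(1) by (intro sum_card_fibres_le) simp_all
      finally have "(n a - 1) * (n b - 1) * N \<le> card R * N"
        by (rule mult_right_mono) simp
      moreover have "(\<Prod>i\<in>I. n i) = n a * n b"
        using I by simp
      moreover have "n a * n b \<le> (n a - 1) * (n b - 1) * N"
        using two le_N four[of a b] I by (intro mult_le_pred_mult_pred) auto
      ultimately show ?thesis
        by (metis le_trans)
    qed
  qed
qed

text \<open>
  The number \<open>k\<close> in the proof is \<open>|V| / N\<close> rounded up, so that a confinement \<open>R\<close> with
  \<open>|V| \<le> |R| * N\<close> has at least \<open>k\<close> elements.
\<close>

lemma dmg_hamming_ge:
  assumes len: "2 \<le> length ns" and two: "\<And>i. i < length ns \<Longrightarrow> 2 \<le> ns ! i"
    and le_N: "\<And>i. i < length ns \<Longrightarrow> ns ! i \<le> N"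
    and four: "\<And>i j. i < j \<Longrightarrow> j < length ns \<Longrightarrow> ns ! i = 2 \<Longrightarrow> ns ! j = 2 \<Longrightarrow> 4 \<le> N"
  shows "card (pverts (hamming ns)) \<le> dmg (hamming ns) * N"
proof -
  let ?V = "pverts (hamming ns)"
  have pos: "0 < ns ! i" if "i < length ns" for i
    using two[OF that] by simp
  have "0 < length ns"
    using len by linarith
  then have N: "0 < N"
    using pos[of 0] le_N[of 0] by linarith
  define k where "k = (LEAST k. card ?V \<le> k * N)"
  have "card ?V \<le> card ?V * N"
    using N by (cases N) simp_all
  then have k: "card ?V \<le> k * N"
    unfolding k_def by (rule LeastI)
  have nonempty: "?V \<noteq> {}"
    using zero_in_hamming[of ns] pos by blast
  have "can_guarantee (hamming ns) k"
  proof (rule can_guarantee_unless_confined[OF finite_pverts_hamming nonempty])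
    fix c
    assume c: "c \<in> ?V"
    define r :: "nat list" where "r = map (\<lambda>i. if c ! i = 0 then 1 else 0) [0..<length ns]"
    have r_c: "r ! i \<noteq> c ! i" if "i < length ns" for i
      using that by (simp add: r_def)
    have "r \<in> ?V"
      using two pos by (auto simp: pverts_hamming r_def less_le_trans[OF _ two])
    moreover have "r \<notin> closed_nbhd (hamming ns) c"
    proof
      assume "r \<in> closed_nbhd (hamming ns) c"
      then obtain i where "\<forall>j<length ns. j \<noteq> i \<longrightarrow> r ! j = c ! j"
        using closed_nbhd_hamming_iff[OF c] by blast
      then have same: "j = i" if "j < length ns" for j
        using r_c that by blast
      have "0 = i" "1 = i"
        by (rule same, use len in linarith)+
      then show False
        by simp
    qed
    ultimately show "\<exists>r\<in>?V. r \<notin> closed_nbhd (hamming ns) c"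
      by blast
  next
    fix R
    assume R: "confinement (hamming ns) R" "R \<noteq> {}"
    then have sub: "R \<subseteq> ?V"
      by (simp add: confinement_def)
    have "(\<Prod>i\<in>{..<length ns}. ns ! i) \<le> card R * N"
    proof (rule card_almost_full)
      show "finite R"
        by (rule finite_subset[OF sub finite_pverts_hamming])
      show "almost_full ((!) ns) {..<length ns} R r" if "r \<in> R" for r
        by (rule almost_full_confinement[OF R(1) that])
      show "i < length r" if "r \<in> R" "i \<in> {..<length ns}" for r i
        using subsetD[OF sub that(1)] that(2) by (simp add: pverts_hamming)
      show "4 \<le> N" if "i \<in> {..<length ns}" "j \<in> {..<length ns}" "i \<noteq> j" "ns ! i = 2" "ns ! j = 2" for i j
        using four[of i j] four[of j i] that by (cases "i < j") auto
    qed (use R(2) two le_N N in simp_all)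
    then have "card ?V \<le> card R * N"
      using card_pverts_hamming[of ns] pos by simp
    then show "k \<le> card R"
      unfolding k_def by (rule Least_le)
  qed
  then have "k \<le> dmg (hamming ns)"
    by (rule dmg_ge[OF finite_pverts_hamming nonempty])
  then have "k * N \<le> dmg (hamming ns) * N"
    by (rule mult_right_mono) simp
  with k show ?thesis
    by (rule le_trans)
qed

section \<open>The damage number of a product of complete graphs\<close>

lemma sum_le_twice_last:
  fixes Q :: "nat \<Rightarrow> real"
  assumes "m \<le> k" "Q m = 1" "\<And>i. m \<le> i \<Longrightarrow> i < k \<Longrightarrow> 2 * Q i \<le> Q (Suc i)"
  shows "(\<Sum>i=m..k. Q i) \<le> 2 * Q k - 1"
  using assms(1,3)
proof (induction k rule: dec_induct)
  case base
  then show ?case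
    using assms(2) by simp
next
  case (step k)
  then have "(\<Sum>i=m..k. Q i) \<le> 2 * Q k - 1" "2 * Q k \<le> Q (Suc k)"
    by simp_all
  then show ?case
    using step.hyps by simp
qed

text \<open>
  Only in the first case of the upper bound is arithmetic needed.  For the hypercube, the
  claimed sum alone is already the bound obtained from \<^const>\<open>rematch\<close>.  Otherwise \<open>n d = 3\<close>, and
  \<^const>\<open>match_first\<close> suffices: with \<open>Q i\<close> denoting the product of the factors
  from the third to the \<open>i\<close>-th, and \<open>S\<close> the sum of \<open>Q i\<close> for \<open>2 \<le> i < d\<close>, it gives \<open>2 + 4 * S\<close>
  against the claimed \<open>2 * Q d + S\<close>.  Here \<open>Q d = 3 * Q (d - 1)\<close>, while \<open>S \<le> 2 * Q (d - 1) - 1\<close>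
  because \<open>Q\<close> at least doubles in every step.
\<close>

theorem theorem1p1:
  fixes d :: nat and n :: "nat \<Rightarrow> nat" and G :: "nat list pair_pre_digraph"
  assumes "2 \<le> d"
    and "2 \<le> n 1"
    and "\<And>i. 1 \<le> i \<Longrightarrow> i < d \<Longrightarrow> n i \<le> n (i + 1)"
    and "G = cartesian_product (map (\<lambda>j. complete_graph (n j)) [1..<d + 1])"
  shows "real (dmg G) \<le>
      (if n 1 = 2 \<and> n 2 = 2 \<and> n d \<le> 3
       then real (card (pverts G)) / 4 + (\<Sum>i = 2..d. \<Prod>j = 3..i. real (n j))
       else real (card (pverts G)) / real (n d) + (\<Sum>i = 0..d - 2. \<Prod>j = 1..i. real (n j)))
    \<and> real (dmg G) \<ge>
      (if n 1 = 2 \<and> n 2 = 2 \<and> n d \<le> 3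
       then real (card (pverts G)) / 4
       else real (card (pverts G)) / real (n d))"
proof -
  define ns where "ns = map n [1..<d + 1]"
  have G: "G = hamming ns"
    by (simp add: assms(4) hamming_def ns_def comp_def)
  have len: "length ns = d"
    by (simp add: ns_def)
  have nth: "ns ! i = n (Suc i)" if "i < d" for i
    using that by (simp add: ns_def del: upt_Suc)
  have mono: "n i \<le> n j" if "1 \<le> i" "i \<le> j" "j \<le> d" for i j
    using that(2,3)
  proof (induction j rule: dec_induct)
    case (step j)
    then show ?case
      using assms(3)[of j] that(1) by simp
  qed simp
  have two: "2 \<le> n i" if "1 \<le> i" "i \<le> d" for i
    using mono[of 1 i] that assms(2) by simp
  have two_ns: "2 \<le> ns ! i" if "i < length ns" for i
    using that two[of "Suc i"] by (simp add: len nth)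
  then have pos_ns: "0 < ns ! i" if "i < length ns" for i
    using that by (meson less_le_trans pos2)
  define P where "P i = (\<Prod>j = 1..i. real (n j))" for i
  define Q where "Q i = (\<Prod>j = 3..i. real (n j))" for i
  have P_Suc: "P (Suc i) = P i * n (Suc i)" and Q_Suc: "2 \<le> i \<Longrightarrow> Q (Suc i) = Q i * n (Suc i)" for i
    by (simp_all add: P_def Q_def)
  have P_pos: "0 \<le> P i" and Q_pos: "0 \<le> Q i" for i
    by (simp_all add: P_def Q_def prod_nonneg)
  have P_ns: "real (\<Prod>i<p. ns ! i) = P p" if "p \<le> d" for p
    using that by (simp add: P_def prod.atLeast1_atMost_eq nth)
  have card: "real (card (pverts G)) = P d"
    unfolding G using card_pverts_hamming[of ns] pos_ns P_ns[of d] by (simp add: len)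
  have le: "real (dmg G) \<le> (\<Sum>p\<in>{1..<d}. P p)"
  proof -
    have "real (dmg G) \<le> real (\<Sum>p\<in>{1..<d}. \<Prod>i<p. ns ! i)"
      unfolding G using dmg_hamming_le[of ns] pos_ns by (simp only: len of_nat_le_iff)
    also have "\<dots> = (\<Sum>p\<in>{1..<d}. P p)"
      unfolding of_nat_sum by (intro sum.cong P_ns) simp_all
    finally show ?thesis .
  qed
  define N where "N = (if n 1 = 2 \<and> n 2 = 2 \<and> n d \<le> 3 then 4 else n d)"
  have "card (pverts G) \<le> dmg G * N"
    unfolding G
  proof (rule dmg_hamming_ge)
    show "ns ! i \<le> N" if "i < length ns" for i
      using that mono[of "Suc i" d] by (auto simp: N_def len nth)
    show "4 \<le> N" if "i < j" "j < length ns" "ns ! i = 2" "ns ! j = 2" for i j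
    proof -
      have "n (Suc i) = 2" "n (Suc j) = 2"
        using that by (simp_all add: len nth)
      then have "n 1 = 2" "n 2 = 2"
        using mono[of 1 "Suc i"] mono[of 2 "Suc j"] two[of 1] two[of 2] that assms(1)
        by (simp_all add: len)
      then show ?thesis
        by (simp add: N_def)
    qed
  qed (use assms(1) two_ns in \<open>simp_all add: len\<close>)
  then have "real (card (pverts G)) \<le> real (dmg G) * real N"
    by (metis of_nat_le_iff of_nat_mult)
  moreover have "0 < N"
    using two[of d] assms(1) by (simp add: N_def)
  ultimately have ge: "real (card (pverts G)) / real N \<le> real (dmg G)"
    by (simp add: divide_le_eq)
  have upper: "real (dmg G) \<le>
      (if n 1 = 2 \<and> n 2 = 2 \<and> n d \<le> 3 then P d / 4 + (\<Sum>i = 2..d. Q i)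
       else P d / real (n d) + (\<Sum>i = 0..d - 2. P i))"
  proof (cases "n 1 = 2 \<and> n 2 = 2 \<and> n d \<le> 3")
    case small: True
    show ?thesis
    proof (cases "n d = 2")
      case True
      have all_two: "n i = 2" if "1 \<le> i" "i \<le> d" for i
        using two[OF that] mono[OF that(1) that(2)] True by simp
      have "dmg G \<le> (\<Sum>p<d - 1. 2 ^ p)"
        unfolding G using dmg_hypercube_le[of ns] by (simp add: len nth all_two)
      then have "real (dmg G) \<le> real (\<Sum>p<d - 1. 2 ^ p)"
        by (simp only: of_nat_le_iff)
      also have "\<dots> = (\<Sum>p<d - 1. 2 ^ p)"
        by simp
      also have "\<dots> = (\<Sum>i = 2..d. 2 ^ (i - 2))"
        by (rule sum.reindex_bij_witness[of _ "\<lambda>i. i - 2" "\<lambda>p. p + 2"]) auto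
      also have "\<dots> = (\<Sum>i = 2..d. Q i)"
      proof (rule sum.cong)
        fix i
        assume "i \<in> {2..d}"
        then have "Q i = (\<Prod>j = 3..i. 2)"
          unfolding Q_def using all_two by (intro prod.cong) simp_all
        then show "2 ^ (i - 2) = Q i"
          by simp
      qed simp
      finally show ?thesis
        using small P_pos[of d] by simp
    next
      case False
      then have n_d: "n d = 3"
        using small two[of d] assms(1) by simp
      then have "d \<noteq> 2"
        using small by auto
      then obtain e where e: "d = Suc e" "2 \<le> e"
        using assms(1) by (cases d) auto
      have P_Q: "P i = 4 * Q i" if "2 \<le> i" for i
        using that
      proof (induction i rule: dec_induct)
        case base
        then show ?case
          using small by (simp add: P_def Q_def numeral_2_eq_2)
      next
        case (step i)
        then show ?case
          by (simp add: P_Suc Q_Suc)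
      qed
      have "(\<Sum>i = 2..e. Q i) \<le> 2 * Q e - 1"
      proof (rule sum_le_twice_last[OF e(2)])
        show "Q 2 = 1"
          by (simp add: Q_def)
        show "2 * Q i \<le> Q (Suc i)" if "2 \<le> i" "i < e" for i
          using that Q_pos[of i] two[of "Suc i"] e(1)
          by (simp add: Q_Suc mult.commute[of 2] mult_left_mono)
      qed
      moreover have "(\<Sum>p\<in>{1..<d}. P p) = 2 + 4 * (\<Sum>i = 2..e. Q i)"
      proof -
        have "{1..<d} = insert 1 {2..e}"
          using e by auto
        then have "(\<Sum>p\<in>{1..<d}. P p) = P 1 + (\<Sum>p = 2..e. P p)"
          by simp
        then show ?thesis
          using small P_Q by (simp add: P_def sum_distrib_left)
      qed
      moreover have "(\<Sum>i = 2..d. Q i) = (\<Sum>i = 2..e. Q i) + Q d" "P d = 4 * Q d" "Q d = 3 * Q e"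
        using e n_d P_Q[of d] Q_Suc[of e] by simp_all
      ultimately show ?thesis
        using small le by simp
    qed
  next
    case False
    obtain e where e: "d = Suc (Suc e)"
      using assms(1) by (metis add_2_eq_Suc le_Suc_ex)
    have "0 < n d"
      using two[of d] assms(1) by simp
    have "(\<Sum>p\<in>{1..<d}. P p) \<le> (\<Sum>p = 0..Suc e. P p)"
      using P_pos e by (intro sum_mono2) auto
    also have "\<dots> = P d / real (n d) + (\<Sum>i = 0..d - 2. P i)"
      using \<open>0 < n d\<close> P_Suc[of "Suc e"] by (simp add: e)
    finally show ?thesis
      unfolding if_not_P[OF False] using le by simp
  qed
  show ?thesis
    using upper ge unfolding card P_def[symmetric] Q_def[symmetric] N_def by auto
qed

end
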